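(* Let $G=(V,E)$ be a finite multigraph (loops allowed). The following are equivalent: (1) $G$ is a $P(2,1)$-graph; (2) $G$ can be constructed from $K_1^1$ or from $K_2^3$ by a finite sequence of 1a, 1b, 2a and 2b moves; (3) $E$ is the disjoint union of the edge sets of a spanning tree $T$ of $G$ and a connected spanning map-graph $M$ of $G$.
   Context: $K_1^1$ is a single vertex with one loop; $K_2^3$ is two vertices with three parallel edges. A graph is $(k,\ell)$-sparse if every subgraph $(V',E')$ with at least one edge has $|E'|\le k|V'|-\ell$, and $(k,\ell)$-tight if also $|E|=k|V|-\ell$. A $P(2,1)$-graph is a $(2,1)$-tight graph $G$ such that $G-e$ is $(2,2)$-tight for some edge $e$. A map-graph is a graph each of whose connected components contains exactly one cycle (a loop counts as a cycle). Moves: (1a) add a new vertex $v_0$ joined by one edge to each of two distinct existing vertices $v_1,v_2$; (1b) add a new vertex $v_0$ joined by two parallel edges to one existing vertex $v_1$; (2a) remove an edge $v_1v_2$ with $v_1\ne v_2$ and add a new vertex $v_0$ joined by one edge to each of $v_1,v_2,v_3$, where $v_3$ is an existing vertex distinct from $v_1,v_2$; (2b) remove an edge $v_1v_2$ with $v_1\ne v_2$ and add a new vertex $v_0$ joined by one edge to $v_1$ and two parallel edges to $v_2$. *)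

theory Defs
  imports Main
begin

text \<open>Undirected multigraphs with labelled edges; an edge \<open>e\<close> is a loop iff \<open>ends e\<close> is a singleton.
  The value of \<open>ends\<close> outside \<open>edges\<close> is irrelevant.\<close>

record ('v, 'e) mgraph =
  verts :: "'v set"
  edges :: "'e set"
  ends :: "'e \<Rightarrow> 'v set"

definition multigraph :: "('v, 'e) mgraph \<Rightarrow> bool" where
  "multigraph G \<longleftrightarrow> (\<forall>e\<in>edges G. \<exists>u\<in>verts G. \<exists>v\<in>verts G. ends G e = {u, v})"

definition finite_multigraph :: "('v, 'e) mgraph \<Rightarrow> bool" where
  "finite_multigraph G \<longleftrightarrow> multigraph G \<and> finite (verts G) \<and> finite (edges G)"

definition subgraph :: "('v, 'e) mgraph \<Rightarrow> ('v, 'e) mgraph \<Rightarrow> bool" where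
  "subgraph H G \<longleftrightarrow>
     multigraph H \<and> verts H \<subseteq> verts G \<and> edges H \<subseteq> edges G \<and> ends H = ends G"

definition spanning_subgraph :: "('v, 'e) mgraph \<Rightarrow> ('v, 'e) mgraph \<Rightarrow> bool" where
  "spanning_subgraph H G \<longleftrightarrow> subgraph H G \<and> verts H = verts G"

definition delete_edge :: "('v, 'e) mgraph \<Rightarrow> 'e \<Rightarrow> ('v, 'e) mgraph" where
  "delete_edge G e = G\<lparr>edges := edges G - {e}\<rparr>"

definition sparse :: "nat \<Rightarrow> nat \<Rightarrow> ('v, 'e) mgraph \<Rightarrow> bool" where
  "sparse k l G \<longleftrightarrow>
     (\<forall>H. subgraph H G \<and> edges H \<noteq> {} \<longrightarrow>
        int (card (edges H)) \<le> int k * int (card (verts H)) - int l)"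

definition tight :: "nat \<Rightarrow> nat \<Rightarrow> ('v, 'e) mgraph \<Rightarrow> bool" where
  "tight k l G \<longleftrightarrow>
     sparse k l G \<and> int (card (edges G)) = int k * int (card (verts G)) - int l"

definition P21_graph :: "('v, 'e) mgraph \<Rightarrow> bool" where
  "P21_graph G \<longleftrightarrow> tight 2 1 G \<and> (\<exists>e\<in>edges G. tight 2 2 (delete_edge G e))"

definition adjacent :: "('v, 'e) mgraph \<Rightarrow> 'v \<Rightarrow> 'v \<Rightarrow> bool" where
  "adjacent G u v \<longleftrightarrow> (\<exists>e\<in>edges G. ends G e = {u, v})"

text \<open>The graph without vertices is not regarded as connected.\<close>

definition connected_graph :: "('v, 'e) mgraph \<Rightarrow> bool" where
  "connected_graph G \<longleftrightarrow>
     verts G \<noteq> {} \<and> (\<forall>u\<in>verts G. \<forall>v\<in>verts G. (adjacent G)\<^sup>*\<^sup>* u v)"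

definition component_of :: "('v, 'e) mgraph \<Rightarrow> ('v, 'e) mgraph \<Rightarrow> bool" where
  "component_of H G \<longleftrightarrow>
     subgraph H G \<and> connected_graph H \<and>
     (\<forall>H'. subgraph H' G \<and> connected_graph H' \<and> subgraph H H' \<longrightarrow> H' = H)"

text \<open>A cycle is identified with its set of edges. Length 1 is a loop, length 2 a pair of
  parallel edges.\<close>

definition cycle_in :: "('v, 'e) mgraph \<Rightarrow> 'e set \<Rightarrow> bool" where
  "cycle_in G C \<longleftrightarrow>
     (\<exists>vs es. vs \<noteq> [] \<and> length es = length vs \<and> distinct vs \<and> distinct es \<and>
        set vs \<subseteq> verts G \<and> set es \<subseteq> edges G \<and>
        (\<forall>i<length vs. ends G (es ! i) = {vs ! i, vs ! (Suc i mod length vs)}) \<and>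
        C = set es)"

definition tree :: "('v, 'e) mgraph \<Rightarrow> bool" where
  "tree T \<longleftrightarrow> connected_graph T \<and> (\<nexists>C. cycle_in T C)"

definition map_graph :: "('v, 'e) mgraph \<Rightarrow> bool" where
  "map_graph M \<longleftrightarrow> (\<forall>H. component_of H M \<longrightarrow> (\<exists>!C. cycle_in H C))"

definition is_K11 :: "('v, 'e) mgraph \<Rightarrow> bool" where
  "is_K11 G \<longleftrightarrow> (\<exists>v e. verts G = {v} \<and> edges G = {e} \<and> ends G e = {v})"

definition is_K23 :: "('v, 'e) mgraph \<Rightarrow> bool" where
  "is_K23 G \<longleftrightarrow>
     (\<exists>u v e1 e2 e3. u \<noteq> v \<and> distinct [e1, e2, e3] \<and>
        verts G = {u, v} \<and> edges G = {e1, e2, e3} \<and>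
        ends G e1 = {u, v} \<and> ends G e2 = {u, v} \<and> ends G e3 = {u, v})"

text \<open>The moves are relations between labelled graphs, each determining its result up to the
  labels of the new vertex and the new edges. In the moves that remove an edge \<open>e\<close>, the label \<open>e\<close>
  may be reused for a new edge; hence the construction does not need more labels than the final
  graph has edges, and the edge type need not be infinite.\<close>

definition move_1a :: "('v, 'e) mgraph \<Rightarrow> ('v, 'e) mgraph \<Rightarrow> bool" where
  "move_1a G G' \<longleftrightarrow>
     (\<exists>v0 v1 v2 f1 f2.
        v0 \<notin> verts G \<and> v1 \<in> verts G \<and> v2 \<in> verts G \<and> v1 \<noteq> v2 \<and>
        distinct [f1, f2] \<and> {f1, f2} \<inter> edges G = {} \<and>
        verts G' = insert v0 (verts G) \<and>
        edges G' = edges G \<union> {f1, f2} \<and>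
        (\<forall>f\<in>edges G. ends G' f = ends G f) \<and>
        ends G' f1 = {v0, v1} \<and> ends G' f2 = {v0, v2})"

definition move_1b :: "('v, 'e) mgraph \<Rightarrow> ('v, 'e) mgraph \<Rightarrow> bool" where
  "move_1b G G' \<longleftrightarrow>
     (\<exists>v0 v1 f1 f2.
        v0 \<notin> verts G \<and> v1 \<in> verts G \<and>
        distinct [f1, f2] \<and> {f1, f2} \<inter> edges G = {} \<and>
        verts G' = insert v0 (verts G) \<and>
        edges G' = edges G \<union> {f1, f2} \<and>
        (\<forall>f\<in>edges G. ends G' f = ends G f) \<and>
        ends G' f1 = {v0, v1} \<and> ends G' f2 = {v0, v1})"

definition move_2a :: "('v, 'e) mgraph \<Rightarrow> ('v, 'e) mgraph \<Rightarrow> bool" where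
  "move_2a G G' \<longleftrightarrow>
     (\<exists>v0 v1 v2 v3 e f1 f2 f3.
        v0 \<notin> verts G \<and> v1 \<in> verts G \<and> v2 \<in> verts G \<and> v3 \<in> verts G \<and> distinct [v1, v2, v3] \<and>
        e \<in> edges G \<and> ends G e = {v1, v2} \<and>
        distinct [f1, f2, f3] \<and> {f1, f2, f3} \<inter> (edges G - {e}) = {} \<and>
        verts G' = insert v0 (verts G) \<and>
        edges G' = (edges G - {e}) \<union> {f1, f2, f3} \<and>
        (\<forall>f\<in>edges G - {e}. ends G' f = ends G f) \<and>
        ends G' f1 = {v0, v1} \<and> ends G' f2 = {v0, v2} \<and> ends G' f3 = {v0, v3})"

definition move_2b :: "('v, 'e) mgraph \<Rightarrow> ('v, 'e) mgraph \<Rightarrow> bool" where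
  "move_2b G G' \<longleftrightarrow>
     (\<exists>v0 v1 v2 e f1 f2 f3.
        v0 \<notin> verts G \<and> v1 \<in> verts G \<and> v2 \<in> verts G \<and> v1 \<noteq> v2 \<and>
        e \<in> edges G \<and> ends G e = {v1, v2} \<and>
        distinct [f1, f2, f3] \<and> {f1, f2, f3} \<inter> (edges G - {e}) = {} \<and>
        verts G' = insert v0 (verts G) \<and>
        edges G' = (edges G - {e}) \<union> {f1, f2, f3} \<and>
        (\<forall>f\<in>edges G - {e}. ends G' f = ends G f) \<and>
        ends G' f1 = {v0, v1} \<and> ends G' f2 = {v0, v2} \<and> ends G' f3 = {v0, v2})"

definition move :: "('v, 'e) mgraph \<Rightarrow> ('v, 'e) mgraph \<Rightarrow> bool" where
  "move G G' \<longleftrightarrow> move_1a G G' \<or> move_1b G G' \<or> move_2a G G' \<or> move_2b G G'"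

definition constructible :: "('v, 'e) mgraph \<Rightarrow> bool" where
  "constructible G \<longleftrightarrow> (\<exists>G0. (is_K11 G0 \<or> is_K23 G0) \<and> move\<^sup>*\<^sup>* G0 G)"

definition tree_map_decomposable :: "('v, 'e) mgraph \<Rightarrow> bool" where
  "tree_map_decomposable G \<longleftrightarrow>
     (\<exists>T M. spanning_subgraph T G \<and> tree T \<and>
        spanning_subgraph M G \<and> connected_graph M \<and> map_graph M \<and>
        edges T \<inter> edges M = {} \<and> edges T \<union> edges M = edges G)"

end

theory Submission
  imports Defs
begin

text \<open>All three conditions say that \<open>G\<close> is the union of two edge-disjoint spanning trees and one
  further edge \<open>e\<^sub>0\<close>: deleting an edge of the unique cycle of the map-graph leaves a tree, and each
  move extends or subdivides the two trees and the edge. Edge-disjoint unions of two trees are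
  (2,2)-sparse, because contracting a vertex set of a tree leaves a connected graph.

  Conversely, if \<open>G - e\<^sub>0\<close> is (2,2)-tight with at least two vertices, degree counting gives a vertex
  \<open>v\<close> of degree 2 or 3 off \<open>e\<^sub>0\<close>, or both ends of \<open>e\<^sub>0\<close> have degree 2 in \<open>G - e\<^sub>0\<close>. In the first case
  \<open>v\<close> can be removed, after joining a suitable pair of its neighbours if the degree is 3. In the
  second case an end of \<open>e\<^sub>0\<close> can be removed and any edge between two of its neighbours takes the
  place of \<open>e\<^sub>0\<close>, unless all its edges are parallel, and then \<open>G\<close> is \<open>K\<^sub>2\<^sup>3\<close>.\<close>

text \<open>Edge set and end map are separate arguments because the arguments below split one edge
  set into two trees and alter the end map by contraction or by rerouting an edge.\<close>

definition adj :: "'e set \<Rightarrow> ('e \<Rightarrow> 'v set) \<Rightarrow> 'v \<Rightarrow> 'v \<Rightarrow> bool" where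
  "adj F g u v \<longleftrightarrow> (\<exists>e\<in>F. g e = {u, v})"

definition linked :: "'v set \<Rightarrow> 'e set \<Rightarrow> ('e \<Rightarrow> 'v set) \<Rightarrow> bool" where
  "linked V F g \<longleftrightarrow> (\<forall>u\<in>V. \<forall>v\<in>V. (adj F g)\<^sup>*\<^sup>* u v)"

definition edges_within :: "'v set \<Rightarrow> 'e set \<Rightarrow> ('e \<Rightarrow> 'v set) \<Rightarrow> bool" where
  "edges_within V F g \<longleftrightarrow> (\<forall>e\<in>F. \<exists>u\<in>V. \<exists>v\<in>V. g e = {u, v})"

text \<open>Connectedness with \<open>card F + 1 = card V\<close> stands in for acyclicity, since
  all sparsity arguments are counts. The agreement with \<open>tree\<close> is
  \<open>tree_iff_counted_tree\<close>.\<close>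

definition counted_tree :: "'v set \<Rightarrow> 'e set \<Rightarrow> ('e \<Rightarrow> 'v set) \<Rightarrow> bool" where
  "counted_tree V F g \<longleftrightarrow>
     finite V \<and> V \<noteq> {} \<and> finite F \<and> edges_within V F g \<and> linked V F g \<and> card F + 1 = card V"

definition induced :: "'e set \<Rightarrow> ('e \<Rightarrow> 'v set) \<Rightarrow> 'v set \<Rightarrow> 'e set" where
  "induced F g S = {e \<in> F. g e \<subseteq> S}"

text \<open>The (2,2)-sparsity condition tested on vertex sets only: among subgraphs on
  \<open>S\<close> the induced one has the most edges. The additive form avoids truncated
  subtraction.\<close>

definition sparse22 :: "'v set \<Rightarrow> 'e set \<Rightarrow> ('e \<Rightarrow> 'v set) \<Rightarrow> bool" where
  "sparse22 V F g \<longleftrightarrow> (\<forall>S\<subseteq>V. S \<noteq> {} \<longrightarrow> card (induced F g S) + 2 \<le> 2 * card S)"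

text \<open>A loop at \<open>v\<close> is counted once, so the cardinality is the degree of
  \<open>v\<close> only in the absence of loops at \<open>v\<close>, which sparsity ensures.\<close>

definition incident :: "'e set \<Rightarrow> ('e \<Rightarrow> 'v set) \<Rightarrow> 'v \<Rightarrow> 'e set" where
  "incident F g v = {e \<in> F. v \<in> g e}"

text \<open>The condition through which the equivalences pass. The extra edge \<open>e\<close> may
  be a loop or parallel to a tree edge.\<close>

definition two_trees_plus_edge :: "('v, 'e) mgraph \<Rightarrow> bool" where
  "two_trees_plus_edge G \<longleftrightarrow>
     (\<exists>A B e. A \<inter> B = {} \<and> e \<notin> A \<union> B \<and> edges G = insert e (A \<union> B) \<and>
        counted_tree (verts G) A (ends G) \<and> counted_tree (verts G) B (ends G))"

section \<open>Connectivity and trees\<close>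

lemma adj_sym: "adj F g u v \<Longrightarrow> adj F g v u"
  by (auto simp: adj_def insert_commute)

lemma reach_sym: "(adj F g)\<^sup>*\<^sup>* u v \<Longrightarrow> (adj F g)\<^sup>*\<^sup>* v u"
  by (induction rule: rtranclp_induct) (auto intro: converse_rtranclp_into_rtranclp adj_sym)

text \<open>It suffices that the images of the two ends of each edge are joined by a walk. With the
  identity as \<open>\<phi>\<close> this handles rerouted edges, with a map collapsing a vertex set
  it handles contraction.\<close>

lemma reach_image:
  assumes "(adj F g)\<^sup>*\<^sup>* u v"
    and "\<And>e x y. e \<in> F \<Longrightarrow> g e = {x, y} \<Longrightarrow> (adj F' g')\<^sup>*\<^sup>* (\<phi> x) (\<phi> y)"
  shows "(adj F' g')\<^sup>*\<^sup>* (\<phi> u) (\<phi> v)"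
  using assms(1)
proof (induction rule: rtranclp_induct)
  case (step y z)
  then show ?case using assms(2) by (meson adj_def rtranclp_trans)
qed simp

lemma linked_image:
  assumes "linked V F g"
    and "\<And>e x y. e \<in> F \<Longrightarrow> g e = {x, y} \<Longrightarrow> (adj F' g')\<^sup>*\<^sup>* (\<phi> x) (\<phi> y)"
  shows "linked (\<phi> ` V) F' g'"
  using assms reach_image[of F g _ _ F' g' \<phi>] unfolding linked_def by blast

lemma linked_mono_edges:
  assumes "linked V F g"
    and "\<And>e x y. e \<in> F \<Longrightarrow> g e = {x, y} \<Longrightarrow> (adj F' g')\<^sup>*\<^sup>* x y"
  shows "linked V F' g'"
  using linked_image[of V F g F' g' "\<lambda>x. x"] assms by simp

lemma linked_insert:
  assumes "linked V F g" "x \<in> V" "(adj F g)\<^sup>*\<^sup>* v x"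
  shows "linked (insert v V) F g"
  using assms unfolding linked_def
  by (metis insert_iff reach_sym rtranclp.rtrancl_refl rtranclp_trans)

text \<open>Contraction of \<open>S\<close> to its element \<open>s\<close>: edges inside
  \<open>S\<close> are dropped, all others keep their labels, and the end map is composed with
  \<open>\<phi>\<close>.\<close>

lemma linked_contract:
  assumes "linked V F g" "s \<in> S" "S \<subseteq> V" "edges_within V F g"
  defines "\<phi> \<equiv> \<lambda>x. if x \<in> S then s else x"
  shows "linked (insert s (V - S)) (F - induced F g S) (\<lambda>e. \<phi> ` g e)"
    and "edges_within (insert s (V - S)) (F - induced F g S) (\<lambda>e. \<phi> ` g e)"
proof -
  have *: "\<phi> ` V = insert s (V - S)" using assms by auto
  have "linked (\<phi> ` V) (F - induced F g S) (\<lambda>e. \<phi> ` g e)"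
  proof (rule linked_image[OF assms(1)])
    fix e x y assume e: "e \<in> F" "g e = {x, y}"
    show "(adj (F - induced F g S) (\<lambda>e. \<phi> ` g e))\<^sup>*\<^sup>* (\<phi> x) (\<phi> y)"
    proof (cases "x \<in> S \<and> y \<in> S")
      case True then show ?thesis by (simp add: \<phi>_def)
    next
      case False
      then have "adj (F - induced F g S) (\<lambda>e. \<phi> ` g e) (\<phi> x) (\<phi> y)"
        using e by (auto simp: adj_def induced_def)
      then show ?thesis by blast
    qed
  qed
  then show "linked (insert s (V - S)) (F - induced F g S) (\<lambda>e. \<phi> ` g e)" using * by simp
  show "edges_within (insert s (V - S)) (F - induced F g S) (\<lambda>e. \<phi> ` g e)"
    unfolding *[symmetric] edges_within_def
  proof
    fix e assume "e \<in> F - induced F g S"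
    then obtain u v where "u \<in> V" "v \<in> V" "g e = {u, v}"
      using assms(4) by (auto simp: edges_within_def)
    then show "\<exists>u\<in>\<phi> ` V. \<exists>v\<in>\<phi> ` V. \<phi> ` g e = {u, v}" by auto
  qed
qed

text \<open>Induction on the number of edges: contracting the ends of an edge removes that edge,
  together with its parallels and the loops at its ends, but at most one vertex.\<close>

lemma linked_card_le:
  assumes "finite F" "finite V" "linked V F g" "edges_within V F g"
  shows "card V \<le> card F + 1"
  using assms
proof (induction "card F" arbitrary: F V g rule: less_induct)
  case less
  show ?case
  proof (cases "F = {}")
    case True
    then have "\<not> adj F g u v" for u v by (auto simp: adj_def)
    then have "(adj F g)\<^sup>*\<^sup>* u v \<Longrightarrow> u = v" for u v by (meson converse_rtranclpE)
    then have "\<forall>u\<in>V. \<forall>v\<in>V. u = v" using less.prems(3) by (auto simp: linked_def)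
    then have "card V \<le> 1" by (simp add: card_le_Suc0_iff_eq less.prems(2))
    then show ?thesis by simp
  next
    case False
    then obtain e where e: "e \<in> F" by auto
    then obtain u v where uv: "u \<in> V" "v \<in> V" "g e = {u, v}"
      using less.prems(4) by (auto simp: edges_within_def)
    let ?I = "induced F g {u, v}"
    let ?g = "\<lambda>e. (\<lambda>x. if x \<in> {u, v} then u else x) ` g e"
    have I: "e \<in> ?I" "?I \<subseteq> F" using e uv by (auto simp: induced_def)
    then have lt: "card (F - ?I) < card F"
      using less.prems(1) by (intro psubset_card_mono) auto
    have "card (insert u (V - {u, v})) \<le> card (F - ?I) + 1"
      using less.hyps[OF lt, of "insert u (V - {u, v})" ?g]
        linked_contract[OF less.prems(3), of u "{u, v}"] less.prems uv by auto
    moreover have "card V \<le> card (insert u (V - {u, v})) + 1"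
    proof -
      have "V \<subseteq> insert v (insert u (V - {u, v}))" by auto
      then have "card V \<le> card (insert v (insert u (V - {u, v})))"
        using less.prems(2) by (intro card_mono) auto
      also have "\<dots> \<le> card (insert u (V - {u, v})) + 1"
        using less.prems(2) by (metis card_insert_if Suc_eq_plus1 finite_Diff finite_insert le_add1 order_refl)
      finally show ?thesis .
    qed
    ultimately show ?thesis using lt by linarith
  qed
qed

text \<open>Contracting \<open>S\<close> leaves a connected graph on |V| - |S| + 1 vertices, which
  has at least |V| - |S| edges; at most |S| - 1 of the |V| - 1 tree edges remain for the inside of
  \<open>S\<close>.\<close>

lemma counted_tree_induced_card:
  assumes T: "counted_tree V F g" and S: "S \<subseteq> V" "S \<noteq> {}"
  shows "card (induced F g S) + 1 \<le> card S"
proof -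
  obtain s where s: "s \<in> S" using S by auto
  have fin: "finite V" "finite F" "finite S" using T S by (auto simp: counted_tree_def finite_subset)
  have "card (insert s (V - S)) \<le> card (F - induced F g S) + 1"
    using linked_contract[of V F g s S] T S s fin
    by (intro linked_card_le[where g = "\<lambda>e. (\<lambda>x. if x \<in> S then s else x) ` g e"])
       (auto simp: counted_tree_def)
  moreover have "card (insert s (V - S)) = card V - card S + 1"
    using s S fin by (simp add: card_Diff_subset)
  moreover have "card (F - induced F g S) = card F - card (induced F g S)"
    using fin by (intro card_Diff_subset) (auto simp: induced_def)
  moreover have "card (induced F g S) \<le> card F" "card S \<le> card V"
    using fin S by (auto simp: induced_def intro: card_mono)
  moreover have "card F + 1 = card V" using T by (simp add: counted_tree_def)
  ultimately show ?thesis by linarith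
qed

lemma counted_tree_singleton: "counted_tree {r} {} g"
  by (auto simp: counted_tree_def edges_within_def linked_def)

lemma counted_tree_add_leaf:
  assumes T: "counted_tree V F g" and "v \<notin> V" "x \<in> V" "f \<notin> F"
    and eq: "\<And>e. e \<in> F \<Longrightarrow> g' e = g e" and f: "g' f = {v, x}"
  shows "counted_tree (insert v V) (insert f F) g'"
proof -
  have "linked V (insert f F) g'"
    by (rule linked_mono_edges[of V F g])
       (use T eq in \<open>auto simp: counted_tree_def adj_def intro!: r_into_rtranclp\<close>)
  then have "linked (insert v V) (insert f F) g'"
    by (rule linked_insert) (use assms in \<open>auto simp: adj_def\<close>)
  moreover have "edges_within (insert v V) (insert f F) g'"
    unfolding edges_within_def
  proof
    fix e assume "e \<in> insert f F"
    then show "\<exists>a\<in>insert v V. \<exists>b\<in>insert v V. g' e = {a, b}"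
      using T assms(3) eq f unfolding counted_tree_def edges_within_def
      by (metis insert_iff)
  qed
  ultimately show ?thesis using assms by (auto simp: counted_tree_def)
qed

text \<open>The path from \<open>x\<close> over \<open>v\<close> to \<open>y\<close> replaces
  \<open>e\<close>. Freshness is asked only with respect to \<open>F - {e}\<close>, since the label
  \<open>e\<close> may be reused for a new edge.\<close>

lemma counted_tree_subdivide:
  assumes T: "counted_tree V F g" and v: "v \<notin> V" and e: "e \<in> F" "g e = {x, y}"
    and f: "f1 \<noteq> f2" "f1 \<notin> F - {e}" "f2 \<notin> F - {e}"
    and eq: "\<And>h. h \<in> F - {e} \<Longrightarrow> g' h = g h" and g': "g' f1 = {v, x}" "g' f2 = {v, y}"
  shows "counted_tree (insert v V) (F - {e} \<union> {f1, f2}) g'"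
proof -
  let ?F = "F - {e} \<union> {f1, f2}"
  have xy: "x \<in> V" "y \<in> V" using T e by (auto simp: counted_tree_def edges_within_def doubleton_eq_iff)
  have a: "adj ?F g' v x" "adj ?F g' v y" using g' by (auto simp: adj_def)
  then have xy_reach: "(adj ?F g')\<^sup>*\<^sup>* x y" "(adj ?F g')\<^sup>*\<^sup>* y x"
    by (meson adj_sym converse_rtranclp_into_rtranclp r_into_rtranclp)+
  have "linked V ?F g'"
  proof (rule linked_mono_edges[of V F g])
    fix h p q assume h: "h \<in> F" "g h = {p, q}"
    show "(adj ?F g')\<^sup>*\<^sup>* p q"
    proof (cases "h = e")
      case True
      then show ?thesis using h e xy_reach by (auto simp: doubleton_eq_iff)
    next
      case False
      then show ?thesis using h eq by (auto simp: adj_def intro!: r_into_rtranclp)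
    qed
  qed (use T in \<open>simp add: counted_tree_def\<close>)
  then have "linked (insert v V) ?F g'"
    by (rule linked_insert[OF _ xy(1)]) (use a in blast)
  moreover have "edges_within (insert v V) ?F g'"
    unfolding edges_within_def
  proof
    fix h assume "h \<in> ?F"
    then consider "h \<in> F - {e}" | "h = f1" | "h = f2" by blast
    then show "\<exists>a\<in>insert v V. \<exists>b\<in>insert v V. g' h = {a, b}"
    proof cases
      case 1
      then show ?thesis using T eq unfolding counted_tree_def edges_within_def
        by (metis DiffD1 insert_iff)
    qed (use g' xy in blast)+
  qed
  moreover have "card ?F = card F + 1"
  proof -
    have fin: "finite F" using T by (simp add: counted_tree_def)
    then have "card ?F = card (F - {e}) + 2" using f by (subst card_Un_disjoint) auto
    then show ?thesis using card.remove[OF fin e(1)] by simp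
  qed
  ultimately show ?thesis using T v by (auto simp: counted_tree_def)
qed

lemma reach_leaves_set:
  assumes "(adj F g)\<^sup>*\<^sup>* u v" "u \<in> S" "v \<notin> S"
  shows "\<exists>x\<in>S. \<exists>y. y \<notin> S \<and> adj F g x y"
  using assms by (induction rule: rtranclp_induct) auto

text \<open>A tree is grown from one vertex: while it misses a vertex, connectedness yields an edge
  leaving its vertex set, and this edge attaches a new leaf.\<close>

lemma spanning_tree_exists:
  assumes fin: "finite V" "finite F" and ne: "V \<noteq> {}" and "linked V F g" and "edges_within V F g"
  shows "\<exists>A\<subseteq>F. counted_tree V A g"
proof -
  obtain r where r: "r \<in> V" using ne by auto
  \<comment> \<open>Here \<open>n\<close> counts the edges of the partial tree;
    \<open>n = card V - 1\<close> makes its vertex set all of \<open>V\<close>.\<close>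
  have "\<exists>S A. S \<subseteq> V \<and> A \<subseteq> F \<and> counted_tree S A g \<and> card S = Suc n" if "Suc n \<le> card V" for n
    using that
  proof (induction n)
    case 0
    show ?case using r counted_tree_singleton[of r g] by - (rule exI[of _ "{r}"], rule exI[of _ "{}"], auto)
  next
    case (Suc n)
    then obtain S A where SA: "S \<subseteq> V" "A \<subseteq> F" "counted_tree S A g" "card S = Suc n" by auto
    have "S \<noteq> V" using Suc.prems SA by auto
    then obtain u v where "u \<in> S" "v \<in> V" "v \<notin> S" using SA by (auto simp: counted_tree_def)
    then obtain x y where xy: "x \<in> S" "y \<notin> S" "adj F g x y"
      using reach_leaves_set[of F g u v S] assms(4) SA(1) unfolding linked_def by blast
    then obtain f where f: "f \<in> F" "g f = {y, x}" by (auto simp: adj_def insert_commute)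
    then have "y \<in> V" using assms(5) by (auto simp: edges_within_def doubleton_eq_iff)
    moreover have "f \<notin> A" using f xy SA(3)
      by (auto simp: counted_tree_def edges_within_def doubleton_eq_iff)
    then have "counted_tree (insert y S) (insert f A) g"
      using counted_tree_add_leaf[OF SA(3) xy(2,1)] f by auto
    ultimately show ?case using SA f xy
      by - (rule exI[of _ "insert y S"], rule exI[of _ "insert f A"], auto simp: counted_tree_def)
  qed
  from this[of "card V - 1"] obtain S A where "S \<subseteq> V" "A \<subseteq> F" "counted_tree S A g" "card S = card V"
    using ne fin by (metis Suc_pred' card_gt_0_iff order_refl)
  then show ?thesis using card_subset_eq[of V S] fin by auto
qed

section \<open>Cycles\<close>

text \<open>Each step of the walk either extends the path or returns to one of its vertices, and
  then the path is cut off at that vertex.\<close>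

lemma simple_path_exists:
  assumes "(adj F g)\<^sup>*\<^sup>* u v"
  shows "\<exists>vs es. vs \<noteq> [] \<and> hd vs = u \<and> last vs = v \<and> distinct vs \<and> length vs = Suc (length es) \<and>
           set es \<subseteq> F \<and> (\<forall>i<length es. g (es ! i) = {vs ! i, vs ! Suc i})"
  using assms
proof (induction rule: rtranclp_induct)
  case base
  show ?case by - (rule exI[of _ "[u]"], rule exI[of _ "[]"], auto)
next
  case (step y z)
  then obtain vs es where p: "vs \<noteq> []" "hd vs = u" "last vs = y" "distinct vs"
    "length vs = Suc (length es)" "set es \<subseteq> F" "\<forall>i<length es. g (es ! i) = {vs ! i, vs ! Suc i}"
    by blast
  obtain e where e: "e \<in> F" "g e = {y, z}" using step by (auto simp: adj_def)
  show ?case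
  proof (cases "z \<in> set vs")
    case True
    then obtain k where k: "k < length vs" "vs ! k = z" by (auto simp: in_set_conv_nth)
    show ?thesis
    proof (intro exI conjI)
      show "take (Suc k) vs \<noteq> []" "hd (take (Suc k) vs) = u" using p by auto
      show "last (take (Suc k) vs) = z" using k by (simp add: take_Suc_conv_app_nth)
      show "distinct (take (Suc k) vs)" using p by simp
      show "length (take (Suc k) vs) = Suc (length (take k es))" using k p by simp
      show "set (take k es) \<subseteq> F" using p by (meson order_trans set_take_subset)
    qed (use p k in auto)
  next
    case False
    have y: "vs ! length es = y" using p by (metis diff_Suc_1 last_conv_nth)
    show ?thesis
    proof (intro exI conjI)
      show "\<forall>i<length (es @ [e]). g ((es @ [e]) ! i) = {(vs @ [z]) ! i, (vs @ [z]) ! Suc i}"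
        using p(5,7) e y by (auto simp: nth_append less_Suc_eq)
    qed (use p e False in auto)
  qed
qed

text \<open>A simple path from \<open>v\<close> to \<open>u\<close> avoiding \<open>e\<close> is
  closed by \<open>e\<close>. For a loop the path is a single vertex and the cycle has length
  1.\<close>

lemma cycle_through_edge:
  assumes "e \<in> edges G" "ends G e = {u, v}" "(adj (edges G - {e}) (ends G))\<^sup>*\<^sup>* v u"
    and "multigraph G"
  shows "\<exists>C. cycle_in G C"
proof -
  let ?g = "ends G"
  obtain vs es where p: "vs \<noteq> []" "hd vs = v" "last vs = u" "distinct vs"
    "length vs = Suc (length es)" "set es \<subseteq> edges G - {e}"
    "\<forall>i<length es. ?g (es ! i) = {vs ! i, vs ! Suc i}"
    using simple_path_exists[OF assms(3)] by blast
  \<comment> \<open>Since the path vertices are distinct, the two ends of a path edge determine its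
    position.\<close>
  have "distinct es"
  proof (unfold distinct_conv_nth, intro allI impI notI)
    fix i j assume ij: "i < length es" "j < length es" "i \<noteq> j" "es ! i = es ! j"
    then have "{vs ! i, vs ! Suc i} = {vs ! j, vs ! Suc j}" using p(7) by metis
    then have "i = j \<and> Suc i = Suc j \<or> i = Suc j \<and> Suc i = j"
      using ij p(4,5) by (auto simp: doubleton_eq_iff nth_eq_iff_index_eq)
    then show False using ij by auto
  qed
  then have d: "distinct (es @ [e])" using p by auto
  have first: "vs ! 0 = v" and final: "vs ! length es = u"
    using p by (auto simp: hd_conv_nth last_conv_nth)
  have ends: "?g ((es @ [e]) ! i) = {vs ! i, vs ! (Suc i mod length vs)}" if "i < length vs" for i
  proof (cases "i < length es")
    case True
    then show ?thesis using p by (simp add: nth_append)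
  next
    case False
    then have "i = length es" using that p by simp
    \<comment> \<open>The closing edge \<open>e\<close> sits at the last index, where the successor
      modulo the length wraps around to the first vertex.\<close>
    then show ?thesis using p(5) first final assms(2) by (simp add: insert_commute)
  qed
  have sub: "?g f \<subseteq> verts G" if "f \<in> edges G" for f
    using assms(4) that unfolding multigraph_def by (metis empty_subsetI insert_subset)
  have "set vs \<subseteq> verts G"
  proof
    fix x assume "x \<in> set vs"
    then obtain i where i: "i < length vs" "x = vs ! i" by (auto simp: in_set_conv_nth)
    then have "x \<in> ?g ((es @ [e]) ! i)" using ends by simp
    moreover have "(es @ [e]) ! i \<in> set (es @ [e])" using i p by (intro nth_mem) simp
    then have "(es @ [e]) ! i \<in> edges G" using p assms(1) by auto
    ultimately show "x \<in> verts G" using sub by blast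
  qed
  then have "cycle_in G (set (es @ [e]))" unfolding cycle_in_def
    by - (rule exI[of _ vs], rule exI[of _ "es @ [e]"], use p d ends assms(1) in auto)
  then show ?thesis by blast
qed

text \<open>The rest of the cycle still joins the two ends of \<open>f\<close>, so every walk can be
  rerouted around it.\<close>

lemma linked_remove_cycle_edge:
  assumes C: "cycle_in G C" "f \<in> C" and L: "linked (verts G) (edges G) (ends G)"
  shows "linked (verts G) (edges G - {f}) (ends G)"
proof -
  let ?g = "ends G" and ?R = "adj (edges G - {f}) (ends G)"
  obtain vs es where c: "vs \<noteq> []" "length es = length vs" "distinct es" "set es \<subseteq> edges G"
    "\<forall>i<length vs. ?g (es ! i) = {vs ! i, vs ! (Suc i mod length vs)}" "C = set es"
    using C(1) unfolding cycle_in_def by blast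
  obtain k where k: "k < length vs" "f = es ! k" using C(2) c by (auto simp: in_set_conv_nth)
  define n where "n = length vs"
  have n: "n > 0" using c by (simp add: n_def)
  \<comment> \<open>The walk starts just after the edge \<open>f\<close> at index \<open>k\<close>
    and makes fewer than \<open>n\<close> steps, so it never uses index \<open>k\<close>; with
    \<open>n - 1\<close> steps it arrives at the other end of \<open>f\<close>.\<close>
  have "?R\<^sup>*\<^sup>* (vs ! (Suc k mod n)) (vs ! ((Suc k + j) mod n))" if "j < n" for j
    using that
  proof (induction j)
    case (Suc j)
    let ?i = "(Suc k + j) mod n"
    have i: "?i < n" using n by simp
    have "?i \<noteq> k"
    proof (cases "Suc k + j < n")
      case False
      then have "?i = Suc k + j - n" using k Suc.prems by (simp add: n_def mod_if)
      then show ?thesis using Suc.prems False by linarith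
    qed simp
    then have "es ! ?i \<noteq> f" using i k c by (simp add: n_def nth_eq_iff_index_eq)
    moreover have "es ! ?i \<in> edges G" using i c by (metis n_def nth_mem subsetD)
    moreover have "?g (es ! ?i) = {vs ! ?i, vs ! (Suc ?i mod n)}" using c(5) i by (simp add: n_def)
    moreover have "Suc ?i mod n = (Suc k + Suc j) mod n" by (simp add: mod_Suc_eq)
    ultimately have "?R (vs ! ?i) (vs ! ((Suc k + Suc j) mod n))" unfolding adj_def by auto
    moreover have "?R\<^sup>*\<^sup>* (vs ! (Suc k mod n)) (vs ! ?i)" using Suc by simp
    ultimately show ?case by simp
  qed simp
  from this[of "n - 1"] have "?R\<^sup>*\<^sup>* (vs ! (Suc k mod n)) (vs ! k)"
    using n k by (simp add: n_def)
  then have r: "?R\<^sup>*\<^sup>* x y" if "?g f = {x, y}" for x y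
    using that c(5) k reach_sym[of "edges G - {f}" ?g] by (auto simp: n_def doubleton_eq_iff)
  show ?thesis
  proof (rule linked_mono_edges[OF L])
    fix e x y assume e: "e \<in> edges G" "?g e = {x, y}"
    show "?R\<^sup>*\<^sup>* x y"
    proof (cases "e = f")
      case False
      then have "?R x y" using e by (auto simp: adj_def)
      then show ?thesis by blast
    qed (use e r in simp)
  qed
qed

section \<open>Trees and connected map-graphs in terms of edge counts\<close>

lemma connected_graph_linked:
  "connected_graph G \<longleftrightarrow> verts G \<noteq> {} \<and> linked (verts G) (edges G) (ends G)"
proof -
  have "adjacent G = adj (edges G) (ends G)" by (intro ext) (simp add: adjacent_def adj_def)
  then show ?thesis by (simp add: connected_graph_def linked_def)
qed

lemma multigraph_edges_within: "multigraph G \<longleftrightarrow> edges_within (verts G) (edges G) (ends G)"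
  by (simp add: multigraph_def edges_within_def)

text \<open>An edge outside a spanning tree would close a cycle, so an acyclic connected graph is
  its own spanning tree. Conversely, deleting a cycle edge from a counted tree would leave a
  connected graph with too few edges.\<close>

lemma tree_iff_counted_tree:
  assumes "finite_multigraph T"
  shows "tree T \<longleftrightarrow> counted_tree (verts T) (edges T) (ends T)"
proof
  have fin: "finite (verts T)" "finite (edges T)" "multigraph T"
    "edges_within (verts T) (edges T) (ends T)"
    using assms by (auto simp: finite_multigraph_def multigraph_edges_within)
  show "counted_tree (verts T) (edges T) (ends T)" if t: "tree T"
  proof -
    have c: "verts T \<noteq> {}" "linked (verts T) (edges T) (ends T)" "\<nexists>C. cycle_in T C"
      using t by (auto simp: tree_def connected_graph_linked)
    obtain A where A: "A \<subseteq> edges T" "counted_tree (verts T) A (ends T)"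
      using spanning_tree_exists[OF fin(1,2) c(1,2) fin(4)] by blast
    have "A = edges T"
    proof (rule ccontr)
      assume "A \<noteq> edges T"
      then obtain e where e: "e \<in> edges T" "e \<notin> A" using A by auto
      obtain u v where uv: "u \<in> verts T" "v \<in> verts T" "ends T e = {u, v}"
        using fin(4) e by (auto simp: edges_within_def)
      have "(adj A (ends T))\<^sup>*\<^sup>* v u" using A(2) uv by (simp add: counted_tree_def linked_def)
      then have "(adj (edges T - {e}) (ends T))\<^sup>*\<^sup>* v u"
        by (rule rtranclp_mono[THEN predicate2D, rotated]) (use A e in \<open>unfold adj_def, blast\<close>)
      then show False using cycle_through_edge[OF e(1) uv(3) _ fin(3)] c(3) by blast
    qed
    then show ?thesis using A by simp
  qed
  show "tree T" if t: "counted_tree (verts T) (edges T) (ends T)"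
  proof -
    have "\<nexists>C. cycle_in T C"
    proof
      assume "\<exists>C. cycle_in T C"
      then obtain C where C: "cycle_in T C" by blast
      then have "C \<noteq> {}" "C \<subseteq> edges T" by (auto simp: cycle_in_def)
      then obtain f where f: "f \<in> C" "f \<in> edges T" by auto
      have "linked (verts T) (edges T - {f}) (ends T)"
        using linked_remove_cycle_edge[OF C f(1)] t by (simp add: counted_tree_def)
      then have "card (verts T) \<le> card (edges T - {f}) + 1"
        using fin by (intro linked_card_le) (auto simp: edges_within_def)
      moreover have "card (edges T) > 0" using f fin by (auto simp: card_gt_0_iff)
      ultimately show False using t f fin by (auto simp: counted_tree_def)
    qed
    then show ?thesis using t by (simp add: tree_def connected_graph_linked counted_tree_def)
  qed
qed

lemma connected_map_graph_iff:
  assumes "connected_graph M" "multigraph M"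
  shows "map_graph M \<longleftrightarrow> (\<exists>!C. cycle_in M C)"
proof -
  have "component_of H M \<longleftrightarrow> H = M" for H
  proof
    assume "component_of H M"
    then show "H = M" using assms by (auto simp: component_of_def subgraph_def)
  next
    assume "H = M"
    then show "component_of H M" using assms by (auto simp: component_of_def subgraph_def)
  qed
  then show ?thesis by (simp add: map_graph_def)
qed

lemma cycle_in_mono:
  assumes "cycle_in H C" "subgraph H G"
  shows "cycle_in G C"
  using assms unfolding cycle_in_def subgraph_def by (metis order_trans)

lemma subgraph_delete_edge: "multigraph G \<Longrightarrow> subgraph (delete_edge G e) G"
  by (auto simp: subgraph_def delete_edge_def multigraph_def)

lemma delete_edge_sel [simp]:
  "verts (delete_edge G e) = verts G" "edges (delete_edge G e) = edges G - {e}"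
  "ends (delete_edge G e) = ends G"
  by (simp_all add: delete_edge_def)

lemma finite_multigraph_delete_edge:
  "finite_multigraph G \<Longrightarrow> finite_multigraph (delete_edge G e)"
  by (auto simp: finite_multigraph_def multigraph_def)

lemma finite_multigraph_subgraph:
  "finite_multigraph G \<Longrightarrow> subgraph H G \<Longrightarrow> finite_multigraph H"
  by (auto simp: finite_multigraph_def subgraph_def intro: finite_subset)

text \<open>Deleting an edge of the only cycle leaves a tree. Conversely, a connected graph with as
  many edges as vertices is no tree, so it has a cycle; the cycle is unique because deleting an edge
  of one cycle already leaves a tree, so that edge lies on every cycle.\<close>

lemma map_graph_iff_tree_plus_edge:
  assumes "finite_multigraph M"
  shows "connected_graph M \<and> map_graph M \<longleftrightarrow>
    (\<exists>e\<in>edges M. counted_tree (verts M) (edges M - {e}) (ends M))" (is "?L \<longleftrightarrow> ?R")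
proof
  have mg: "multigraph M" using assms by (simp add: finite_multigraph_def)
  have tree_iff: "tree (delete_edge M e) \<longleftrightarrow> counted_tree (verts M) (edges M - {e}) (ends M)" for e
    using tree_iff_counted_tree[OF finite_multigraph_delete_edge[OF assms, of e]] by simp
  show ?R if L: ?L
  proof -
    obtain C where C: "cycle_in M C" and uniq: "\<And>D. cycle_in M D \<Longrightarrow> D = C"
      using L connected_map_graph_iff[OF _ mg] by blast
    have "C \<noteq> {}" "C \<subseteq> edges M" using C by (auto simp: cycle_in_def)
    then obtain e where e: "e \<in> C" "e \<in> edges M" by auto
    have "connected_graph (delete_edge M e)"
      using L linked_remove_cycle_edge[OF C e(1)] by (simp add: connected_graph_linked)
    moreover have "\<not> cycle_in (delete_edge M e) D" for D
    proof
      assume D: "cycle_in (delete_edge M e) D"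
      then have "D = C" using uniq cycle_in_mono subgraph_delete_edge[OF mg] by blast
      moreover have "D \<subseteq> edges M - {e}" using D by (auto simp: cycle_in_def)
      ultimately show False using e by auto
    qed
    ultimately have "tree (delete_edge M e)" by (simp add: tree_def)
    then show ?R using tree_iff e by blast
  qed
  show ?L if R: ?R
  proof -
    obtain e where e: "e \<in> edges M" "counted_tree (verts M) (edges M - {e}) (ends M)"
      using R by blast
    have fin: "finite (edges M)" using assms by (simp add: finite_multigraph_def)
    have card: "card (edges M) = card (verts M)" and ne: "verts M \<noteq> {}"
      using e(2) card.remove[OF fin e(1)] unfolding counted_tree_def by linarith+
    have L: "linked (verts M) (edges M) (ends M)"
      by (rule linked_mono_edges[of _ "edges M - {e}" "ends M"])
         (use e in \<open>auto simp: counted_tree_def adj_def intro!: r_into_rtranclp\<close>)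
    have con: "connected_graph M" using L ne by (simp add: connected_graph_linked)
    have ex: "\<exists>C. cycle_in M C"
    proof (rule ccontr)
      assume "\<nexists>C. cycle_in M C"
      then have "tree M" using con by (simp add: tree_def)
      then show False using tree_iff_counted_tree[OF assms] card by (simp add: counted_tree_def)
    qed
    \<comment> \<open>Cycles are edge sets, so containment for all ordered pairs of cycles gives
      equality. If \<open>f\<close> were on \<open>C\<close> but not on \<open>D\<close>, the tree
      left by deleting \<open>f\<close> would contain \<open>D\<close>.\<close>
    have sub: "C \<subseteq> D" if C: "cycle_in M C" and D: "cycle_in M D" for C D
    proof
      fix f assume f: "f \<in> C"
      show "f \<in> D"
      proof (rule ccontr)
        assume nf: "f \<notin> D"
        have "C \<subseteq> edges M" using C by (auto simp: cycle_in_def)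
        then have "counted_tree (verts M) (edges M - {f}) (ends M)"
          using linked_remove_cycle_edge[OF C f L] f assms card ne card_Suc_Diff1[OF fin, of f]
          by (auto simp: counted_tree_def finite_multigraph_def multigraph_edges_within
              edges_within_def simp del: card_Diff_insert card_Diff_singleton)
        then have "tree (delete_edge M f)" using tree_iff by simp
        moreover have "cycle_in (delete_edge M f) D"
        proof -
          obtain vs es where c: "vs \<noteq> []" "length es = length vs" "distinct vs" "distinct es"
            "set vs \<subseteq> verts M" "set es \<subseteq> edges M" "D = set es"
            "\<forall>i<length vs. ends M (es ! i) = {vs ! i, vs ! (Suc i mod length vs)}"
            using D unfolding cycle_in_def by blast
          moreover have "set es \<subseteq> edges M - {f}" using c nf by blast
          ultimately show ?thesis unfolding cycle_in_def delete_edge_sel by blast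
        qed
        ultimately show False by (auto simp: tree_def)
      qed
    qed
    have "\<exists>!C. cycle_in M C" using ex sub by (meson subset_antisym)
    then show ?L using con connected_map_graph_iff[OF con mg] by simp
  qed
qed

lemma tree_map_decomposable_iff:
  assumes "finite_multigraph G"
  shows "tree_map_decomposable G \<longleftrightarrow> two_trees_plus_edge G"
proof
  show "two_trees_plus_edge G" if "tree_map_decomposable G"
  proof -
    obtain T M where TM: "spanning_subgraph T G" "tree T" "spanning_subgraph M G"
      "connected_graph M" "map_graph M" "edges T \<inter> edges M = {}" "edges T \<union> edges M = edges G"
      using \<open>tree_map_decomposable G\<close> by (auto simp: tree_map_decomposable_def)
    have fin: "finite_multigraph T" "finite_multigraph M"
      using TM assms by (auto simp: spanning_subgraph_def intro: finite_multigraph_subgraph)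
    have sel: "verts T = verts G" "verts M = verts G" "ends T = ends G" "ends M = ends G"
      using TM by (auto simp: spanning_subgraph_def subgraph_def)
    obtain e where "e \<in> edges M" "counted_tree (verts G) (edges M - {e}) (ends G)"
      using map_graph_iff_tree_plus_edge[OF fin(2)] TM sel by auto
    moreover have "counted_tree (verts G) (edges T) (ends G)"
      using tree_iff_counted_tree[OF fin(1)] TM sel by simp
    ultimately show ?thesis unfolding two_trees_plus_edge_def
      by - (rule exI[of _ "edges T"], rule exI[of _ "edges M - {e}"], rule exI[of _ e],
          use TM in auto)
  qed
  show "tree_map_decomposable G" if "two_trees_plus_edge G"
  proof -
    obtain A B e where D: "A \<inter> B = {}" "e \<notin> A \<union> B" "edges G = insert e (A \<union> B)"
      "counted_tree (verts G) A (ends G)" "counted_tree (verts G) B (ends G)"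
      using \<open>two_trees_plus_edge G\<close> by (auto simp: two_trees_plus_edge_def)
    define T where "T = G\<lparr>edges := A\<rparr>"
    define M where "M = G\<lparr>edges := insert e B\<rparr>"
    have sp: "spanning_subgraph T G" "spanning_subgraph M G" using assms D
      by (auto simp: T_def M_def spanning_subgraph_def subgraph_def finite_multigraph_def
          multigraph_def)
    then have fin: "finite_multigraph T" "finite_multigraph M"
      using assms by (auto simp: spanning_subgraph_def intro: finite_multigraph_subgraph)
    have "tree T" using tree_iff_counted_tree[OF fin(1)] D by (simp add: T_def)
    moreover have "connected_graph M \<and> map_graph M"
      unfolding map_graph_iff_tree_plus_edge[OF fin(2)]
      by (rule bexI[of _ e]) (use D in \<open>auto simp: M_def\<close>)
    ultimately show ?thesis unfolding tree_map_decomposable_def using sp D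
      by - (rule exI[of _ T], rule exI[of _ M], auto simp: T_def M_def)
  qed
qed

section \<open>The moves preserve the decomposition\<close>

text \<open>On one vertex both trees have no edges and the loop is the extra edge; three parallel
  edges give one to each tree and one extra.\<close>

lemma two_trees_plus_edge_base:
  assumes "is_K11 G \<or> is_K23 G"
  shows "two_trees_plus_edge G"
  using assms
proof
  assume "is_K11 G"
  then obtain v e where "verts G = {v}" "edges G = {e}" by (auto simp: is_K11_def)
  then show ?thesis unfolding two_trees_plus_edge_def
    by - (rule exI[of _ "{}"], rule exI[of _ "{}"], rule exI[of _ e],
          simp add: counted_tree_singleton)
next
  assume "is_K23 G"
  then obtain u v e1 e2 e3 where K: "u \<noteq> v" "distinct [e1, e2, e3]" "verts G = {u, v}"
    "edges G = {e1, e2, e3}" "ends G e1 = {u, v}" "ends G e2 = {u, v}"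
    by (auto simp: is_K23_def)
  have "counted_tree {u, v} {e} (ends G)" if "ends G e = {u, v}" for e
    using counted_tree_add_leaf[OF counted_tree_singleton[of v "ends G"], of u v e "ends G"] that K(1)
    by simp
  then show ?thesis unfolding two_trees_plus_edge_def
    by - (rule exI[of _ "{e1}"], rule exI[of _ "{e2}"], rule exI[of _ e3], use K in auto)
qed

text \<open>The new vertex becomes a leaf of both trees. Moves 1a and 1b are both covered, as
  \<open>x = y\<close> is allowed.\<close>

lemma two_trees_plus_edge_add_vertex:
  assumes G: "two_trees_plus_edge G"
    and v: "v \<notin> verts G" "x \<in> verts G" "y \<in> verts G"
    and f: "f1 \<noteq> f2" "{f1, f2} \<inter> edges G = {}"
    and G': "verts G' = insert v (verts G)" "edges G' = edges G \<union> {f1, f2}"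
      "\<forall>f\<in>edges G. ends G' f = ends G f" "ends G' f1 = {v, x}" "ends G' f2 = {v, y}"
  shows "two_trees_plus_edge G'"
proof -
  obtain A B e where D: "A \<inter> B = {}" "e \<notin> A \<union> B" "edges G = insert e (A \<union> B)"
      "counted_tree (verts G) A (ends G)" "counted_tree (verts G) B (ends G)"
    using G by (auto simp: two_trees_plus_edge_def)
  have "counted_tree (verts G') (insert f1 A) (ends G')"
    unfolding G'(1) by (rule counted_tree_add_leaf[OF D(4) v(1,2)]) (use f G' D in auto)
  moreover have "counted_tree (verts G') (insert f2 B) (ends G')"
    unfolding G'(1) by (rule counted_tree_add_leaf[OF D(5) v(1,3)]) (use f G' D in auto)
  ultimately show ?thesis unfolding two_trees_plus_edge_def
    by - (rule exI[of _ "insert f1 A"], rule exI[of _ "insert f2 B"], rule exI[of _ e],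
          use D(1-3) f G'(2) in auto)
qed

text \<open>If \<open>d\<close> is a tree edge, it is subdivided and \<open>f3\<close> attaches
  \<open>v\<close> to the other tree as a leaf. If \<open>d\<close> is the extra edge,
  \<open>f1\<close> and \<open>f2\<close> attach \<open>v\<close> to the two trees and
  \<open>f3\<close> becomes extra. Move 2b is the case \<open>z = y\<close>.\<close>

lemma two_trees_plus_edge_split_edge:
  assumes G: "two_trees_plus_edge G"
    and v: "v \<notin> verts G" "x \<in> verts G" "y \<in> verts G" "z \<in> verts G"
    and d: "d \<in> edges G" "ends G d = {x, y}"
    and f: "distinct [f1, f2, f3]" "{f1, f2, f3} \<inter> (edges G - {d}) = {}"
    and G': "verts G' = insert v (verts G)" "edges G' = (edges G - {d}) \<union> {f1, f2, f3}"
      "\<forall>f\<in>edges G - {d}. ends G' f = ends G f"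
      "ends G' f1 = {v, x}" "ends G' f2 = {v, y}" "ends G' f3 = {v, z}"
  shows "two_trees_plus_edge G'"
proof -
  obtain A B e where D: "A \<inter> B = {}" "e \<notin> A \<union> B" "edges G = insert e (A \<union> B)"
      "counted_tree (verts G) A (ends G)" "counted_tree (verts G) B (ends G)" "d \<in> A \<or> d = e"
  proof -
    obtain A B e where D: "A \<inter> B = {}" "e \<notin> A \<union> B" "edges G = insert e (A \<union> B)"
      "counted_tree (verts G) A (ends G)" "counted_tree (verts G) B (ends G)"
      using G by (auto simp: two_trees_plus_edge_def)
    show ?thesis
    proof (cases "d \<in> B")
      case True
      then show ?thesis using that[of B A e] D by (auto simp: Un_commute Int_commute)
    next
      case False
      then show ?thesis using that[of A B e] D d by auto
    qed
  qed
  show ?thesis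
  proof (cases "d = e")
    case True
    have "counted_tree (verts G') (insert f1 A) (ends G')"
      unfolding G'(1) by (rule counted_tree_add_leaf[OF D(4) v(1,2)]) (use f G' D True in auto)
    moreover have "counted_tree (verts G') (insert f2 B) (ends G')"
      unfolding G'(1) by (rule counted_tree_add_leaf[OF D(5) v(1,3)]) (use f G' D True in auto)
    ultimately show ?thesis unfolding two_trees_plus_edge_def
      by - (rule exI[of _ "insert f1 A"], rule exI[of _ "insert f2 B"], rule exI[of _ f3],
          use D(1-3) f G'(2) True in auto)
  next
    case False
    then have dA: "d \<in> A" "d \<notin> B" using D by auto
    have "counted_tree (verts G') (A - {d} \<union> {f1, f2}) (ends G')"
      unfolding G'(1) by (rule counted_tree_subdivide[OF D(4) v(1) dA(1) d(2)]) (use f G' D in auto)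
    moreover have "counted_tree (verts G') (insert f3 B) (ends G')"
      unfolding G'(1) by (rule counted_tree_add_leaf[OF D(5) v(1,4)]) (use f G' D dA in auto)
    \<comment> \<open>A new label may be \<open>d\<close> itself; it is fresh only with respect to
      the remaining edges.\<close>
    moreover have nf: "h \<notin> insert e (A \<union> B) - {d}" if "h \<in> {f1, f2, f3}" for h
      using f(2) D(3) that by blast
    have "(A - {d} \<union> {f1, f2}) \<inter> insert f3 B = {}"
      using nf[of f1] nf[of f2] nf[of f3] f(1) D(1) dA by auto
    moreover have "e \<notin> (A - {d} \<union> {f1, f2}) \<union> insert f3 B"
      using nf[of f1] nf[of f2] nf[of f3] D(2) False by auto
    moreover have "edges G' = insert e ((A - {d} \<union> {f1, f2}) \<union> insert f3 B)"
      unfolding G'(2) D(3) using dA False by blast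
    ultimately show ?thesis unfolding two_trees_plus_edge_def by blast
  qed
qed

lemma two_trees_plus_edge_move:
  assumes G: "two_trees_plus_edge G" and "move G G'"
  shows "two_trees_plus_edge G'"
  using assms(2) unfolding move_def
proof (elim disjE)
  assume "move_1a G G'"
  then show ?thesis unfolding move_1a_def
    by (elim exE conjE) (rule two_trees_plus_edge_add_vertex[OF G]; (assumption | simp))
next
  assume "move_1b G G'"
  then show ?thesis unfolding move_1b_def
    by (elim exE conjE) (rule two_trees_plus_edge_add_vertex[OF G]; (assumption | simp))
next
  assume "move_2a G G'"
  then show ?thesis unfolding move_2a_def
    by (elim exE conjE) (rule two_trees_plus_edge_split_edge[OF G]; (assumption | simp))
next
  assume "move_2b G G'"
  then show ?thesis unfolding move_2b_def
    by (elim exE conjE) (rule two_trees_plus_edge_split_edge[OF G]; (assumption | simp))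
qed

lemma constructible_two_trees_plus_edge:
  assumes "constructible G"
  shows "two_trees_plus_edge G"
proof -
  obtain G0 where G0: "is_K11 G0 \<or> is_K23 G0" "move\<^sup>*\<^sup>* G0 G"
    using assms by (auto simp: constructible_def)
  from G0(2) show ?thesis
    by (induction rule: rtranclp_induct)
       (use G0(1) two_trees_plus_edge_base two_trees_plus_edge_move in blast)+
qed

section \<open>Sparsity\<close>

lemma sparse22D: "sparse22 V F g \<Longrightarrow> S \<subseteq> V \<Longrightarrow> S \<noteq> {} \<Longrightarrow> card (induced F g S) + 2 \<le> 2 * card S"
  by (simp add: sparse22_def)

text \<open>Every subgraph on a vertex set is contained in the induced one. Vertex sets inducing no
  edge, which \<open>sparse\<close> ignores, satisfy the bound because they are nonempty.\<close>

lemma sparse_2_2_iff_sparse22: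
  assumes "finite_multigraph G"
  shows "sparse 2 2 G \<longleftrightarrow> sparse22 (verts G) (edges G) (ends G)"
proof
  have fin: "finite (verts G)" "finite (edges G)" and mg: "multigraph G"
    using assms by (auto simp: finite_multigraph_def)
  show "sparse22 (verts G) (edges G) (ends G)" if sp: "sparse 2 2 G"
    unfolding sparse22_def
  proof (intro allI impI)
    fix S assume S: "S \<subseteq> verts G" "S \<noteq> {}"
    let ?I = "induced (edges G) (ends G) S"
    have S0: "card S \<ge> 1" using S fin by (simp add: Suc_leI card_gt_0_iff finite_subset)
    show "card ?I + 2 \<le> 2 * card S"
    proof (cases "?I = {}")
      case True
      then show ?thesis using S0 by simp
    next
      case False
      let ?H = "\<lparr>verts = S, edges = ?I, ends = ends G\<rparr>"
      have "multigraph ?H" unfolding multigraph_def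
      proof
        fix e assume "e \<in> edges ?H"
        then have e: "e \<in> edges G" "ends G e \<subseteq> S" by (auto simp: induced_def)
        then obtain u v where "ends G e = {u, v}" using mg unfolding multigraph_def by blast
        then show "\<exists>u\<in>verts ?H. \<exists>v\<in>verts ?H. ends ?H e = {u, v}"
          using e(2) by auto
      qed
      then have "subgraph ?H G" using S by (auto simp: subgraph_def induced_def)
      then have "int (card (edges ?H)) \<le> int 2 * int (card (verts ?H)) - int 2"
        using sp False unfolding sparse_def by auto
      then show ?thesis by simp
    qed
  qed
  show "sparse 2 2 G" if sp: "sparse22 (verts G) (edges G) (ends G)"
    unfolding sparse_def
  proof (intro allI impI)
    fix H assume H: "subgraph H G \<and> edges H \<noteq> {}"
    then have "verts H \<subseteq> verts G" "verts H \<noteq> {}" by (auto simp: subgraph_def multigraph_def)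
    then have "card (induced (edges G) (ends G) (verts H)) + 2 \<le> 2 * card (verts H)"
      using sp by (auto simp: sparse22_def)
    moreover have "edges H \<subseteq> induced (edges G) (ends G) (verts H)"
      using H by (fastforce simp: subgraph_def multigraph_def induced_def)
    then have "card (edges H) \<le> card (induced (edges G) (ends G) (verts H))"
      using fin by (intro card_mono) (auto simp: induced_def)
    ultimately show "int (card (edges H)) \<le> int 2 * int (card (verts H)) - int 2" by linarith
  qed
qed

text \<open>Restoring \<open>e\<close> adds at most one edge to any subgraph, so (2,2)-sparsity of G
  - e already gives (2,1)-sparsity of G; the two tightness counts are the same equation.\<close>

lemma P21_graph_iff:
  assumes "finite_multigraph G"
  shows "P21_graph G \<longleftrightarrow>
    (\<exists>e\<in>edges G. sparse22 (verts G) (edges G - {e}) (ends G)) \<and>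
    card (edges G) + 1 = 2 * card (verts G)"
proof -
  have fin: "finite (edges G)" using assms by (auto simp: finite_multigraph_def)
  have sp: "sparse 2 2 (delete_edge G e) \<longleftrightarrow> sparse22 (verts G) (edges G - {e}) (ends G)" for e
    using sparse_2_2_iff_sparse22[OF finite_multigraph_delete_edge[OF assms, of e]] by simp
  have cd: "card (edges G) = card (edges G - {e}) + 1" if "e \<in> edges G" for e
    using card.remove[OF fin that] by simp
  have "sparse 2 1 G" if e: "e \<in> edges G" "sparse22 (verts G) (edges G - {e}) (ends G)" for e
    unfolding sparse_def
  proof (intro allI impI)
    fix H assume H: "subgraph H G \<and> edges H \<noteq> {}"
    let ?I = "induced (edges G - {e}) (ends G) (verts H)"
    have "verts H \<subseteq> verts G" "verts H \<noteq> {}" using H by (auto simp: subgraph_def multigraph_def)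
    then have "card ?I + 2 \<le> 2 * card (verts H)"
      using e by (auto simp: sparse22_def)
    moreover have "edges H \<subseteq> insert e ?I"
      using H by (fastforce simp: subgraph_def multigraph_def induced_def)
    then have "card (edges H) \<le> card (insert e ?I)"
      using fin by (intro card_mono) (auto simp: induced_def)
    moreover have "card (insert e ?I) \<le> card ?I + 1"
      using fin by (simp add: card_insert_if induced_def)
    ultimately show "int (card (edges H)) \<le> int 2 * int (card (verts H)) - int 1" by linarith
  qed
  moreover have "int (card (edges G - {e})) = int 2 * int (card (verts G)) - int 2"
    if "e \<in> edges G" "card (edges G) + 1 = 2 * card (verts G)" for e
    using cd[OF that(1)] that(2) by linarith
  moreover have "int (card (edges G)) = int 2 * int (card (verts G)) - int 1 \<longleftrightarrow>
      card (edges G) + 1 = 2 * card (verts G)" by linarith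
  ultimately show ?thesis unfolding P21_graph_def tight_def sp delete_edge_sel by blast
qed

text \<open>On a vertex set \<open>S\<close> each tree induces at most |S| - 1 edges, which add up
  to the bound 2|S| - 2.\<close>

lemma two_trees_plus_edge_P21_graph:
  assumes fin: "finite_multigraph G" and "two_trees_plus_edge G"
  shows "P21_graph G"
proof -
  obtain A B e where D: "A \<inter> B = {}" "e \<notin> A \<union> B" "edges G = insert e (A \<union> B)"
    "counted_tree (verts G) A (ends G)" "counted_tree (verts G) B (ends G)"
    using assms(2) by (auto simp: two_trees_plus_edge_def)
  have AB: "finite A" "finite B" "card A + 1 = card (verts G)" "card B + 1 = card (verts G)"
    using D by (auto simp: counted_tree_def)
  have "sparse22 (verts G) (edges G - {e}) (ends G)" unfolding sparse22_def
  proof (intro allI impI)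
    fix S assume S: "S \<subseteq> verts G" "S \<noteq> {}"
    have "induced (edges G - {e}) (ends G) S = induced A (ends G) S \<union> induced B (ends G) S"
      using D by (auto simp: induced_def)
    then have "card (induced (edges G - {e}) (ends G) S)
        \<le> card (induced A (ends G) S) + card (induced B (ends G) S)"
      by (simp add: card_Un_le)
    then show "card (induced (edges G - {e}) (ends G) S) + 2 \<le> 2 * card S"
      using counted_tree_induced_card[OF D(4) S] counted_tree_induced_card[OF D(5) S] by linarith
  qed
  moreover have "card (edges G) + 1 = 2 * card (verts G)"
    using D AB by (simp add: card_Un_disjoint)
  ultimately show ?thesis using P21_graph_iff[OF fin] D(3) by blast
qed

section \<open>Vertices of small degree\<close>

lemma sparse22_mono:
  assumes "sparse22 V F g" "V' \<subseteq> V" "F' \<subseteq> F" "finite F" "\<And>e. e \<in> F' \<Longrightarrow> g' e = g e"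
  shows "sparse22 V' F' g'"
  unfolding sparse22_def
proof (intro allI impI)
  fix S assume S: "S \<subseteq> V'" "S \<noteq> {}"
  have "card (induced F' g' S) \<le> card (induced F g S)"
    using assms by (intro card_mono) (auto simp: induced_def)
  moreover have "card (induced F g S) + 2 \<le> 2 * card S"
    using sparse22D[OF assms(1)] assms(2) S by auto
  ultimately show "card (induced F' g' S) + 2 \<le> 2 * card S" by linarith
qed

lemma sparse22_no_loop:
  assumes "sparse22 V F g" "finite F" "u \<in> V" "e \<in> F"
  shows "g e \<noteq> {u}"
proof
  assume "g e = {u}"
  then have "e \<in> induced F g {u}" using assms by (simp add: induced_def)
  then have "card (induced F g {u}) > 0"
    using assms by (auto simp: card_gt_0_iff induced_def)
  moreover have "card (induced F g {u}) + 2 \<le> 2 * card {u}"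
    by (rule sparse22D[OF assms(1)]) (use assms in auto)
  ultimately show False by simp
qed

lemma incident_other_end:
  assumes "sparse22 V F g" "finite F" "edges_within V F g" "e \<in> incident F g v"
  shows "\<exists>x\<in>V - {v}. g e = {v, x}"
proof -
  have e: "e \<in> F" "v \<in> g e" using assms(4) by (auto simp: incident_def)
  then obtain p q where pq: "p \<in> V" "q \<in> V" "g e = {p, q}"
    using assms(3) by (auto simp: edges_within_def)
  moreover have "p \<noteq> q" using sparse22_no_loop[OF assms(1,2) pq(1) e(1)] pq by auto
  ultimately show ?thesis using e by auto
qed

text \<open>Double counting of vertex-edge incidences: sparsity excludes loops, so every edge has
  exactly two ends.\<close>

lemma sum_card_incident:
  assumes "sparse22 V F g" "finite V" "finite F" "edges_within V F g"
  shows "(\<Sum>v\<in>V. card (incident F g v)) = 2 * card F"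
  unfolding incident_def
proof (rule sum_multicount[OF assms(2,3)], rule ballI)
  fix e assume e: "e \<in> F"
  then obtain p q where pq: "p \<in> V" "q \<in> V" "g e = {p, q}"
    using assms(4) by (auto simp: edges_within_def)
  have "p \<noteq> q" using sparse22_no_loop[OF assms(1,3) pq(1) e] pq by auto
  moreover have "{v \<in> V. v \<in> g e} = {p, q}" using pq by auto
  ultimately show "card {v \<in> V. v \<in> g e} = 2" by simp
qed

text \<open>The other vertices induce at most 2(|V| - 1) - 2 edges, so at least two of the 2|V| - 2
  edges are at \<open>v\<close>.\<close>

lemma card_incident_ge_2:
  assumes "sparse22 V F g" "finite V" "finite F" "edges_within V F g"
    and "card F + 2 = 2 * card V" "card V \<ge> 2" "v \<in> V"
  shows "card (incident F g v) \<ge> 2"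
proof -
  have "F \<subseteq> induced F g (V - {v}) \<union> incident F g v"
    using assms(4) by (fastforce simp: induced_def incident_def edges_within_def)
  then have "card F \<le> card (induced F g (V - {v}) \<union> incident F g v)"
    using assms(3) by (intro card_mono) (auto simp: induced_def incident_def)
  also have "\<dots> \<le> card (induced F g (V - {v})) + card (incident F g v)" by (rule card_Un_le)
  finally have "card F \<le> card (induced F g (V - {v})) + card (incident F g v)" .
  moreover have c: "card V = card (V - {v}) + 1" using card.remove[OF assms(2,7)] by simp
  then have "card (V - {v}) \<noteq> 0" using assms(6) by linarith
  then have "V - {v} \<noteq> {}" by (metis card.empty)
  then have "card (induced F g (V - {v})) + 2 \<le> 2 * card (V - {v})"
    by (intro sparse22D[OF assms(1)]) auto
  ultimately show ?thesis using assms(5) c by linarith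
qed

text \<open>The degrees of a (2,2)-tight graph add up to 4|V| - 4, so if every vertex off a given edge has
  degree at least 4, the ends of that edge must absorb the whole deficit.\<close>

lemma small_degree_vertex:
  assumes F: "sparse22 V F g" "finite V" "finite F" "edges_within V F g"
    and t: "card F + 2 = 2 * card V" "card V \<ge> 2" and D: "D = {p, q}" "D \<subseteq> V"
  shows "(\<exists>v\<in>V - D. card (incident F g v) = 2 \<or> card (incident F g v) = 3) \<or>
    (p \<noteq> q \<and> card (incident F g p) = 2 \<and> card (incident F g q) = 2)"
proof (rule ccontr)
  let ?d = "\<lambda>v. card (incident F g v)"
  assume neg: "\<not> ?thesis"
  have ge2: "?d v \<ge> 2" if "v \<in> V" for v using card_incident_ge_2[OF F t that] .
  have ge4: "?d v \<ge> 4" if "v \<in> V - D" for v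
  proof -
    have "?d v \<noteq> 2" "?d v \<noteq> 3" using neg that by blast+
    moreover have "?d v \<ge> 2" using ge2 that by blast
    ultimately show ?thesis by linarith
  qed
  have "(\<Sum>v\<in>V - D. 4) \<le> (\<Sum>v\<in>V - D. ?d v)" by (rule sum_mono) (use ge4 in auto)
  then have "4 * card (V - D) \<le> (\<Sum>v\<in>V - D. ?d v)" by simp
  moreover have "(\<Sum>v\<in>V. ?d v) = (\<Sum>v\<in>V - D. ?d v) + (\<Sum>v\<in>D. ?d v)"
    using F(2) D(2) by (rule sum.subset_diff[rotated])
  moreover have "card V = card (V - D) + card D"
    using F(2) D(2) by (simp add: card_Diff_subset card_mono finite_subset)
  ultimately have s: "(\<Sum>v\<in>D. ?d v) + 4 \<le> 4 * card D"
    using sum_card_incident[OF F] t(1) by linarith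
  have pq: "?d p \<ge> 2" "?d q \<ge> 2" using ge2 D by auto
  show False
  \<comment> \<open>A loop would force degree at most 0 at \<open>p\<close>, against the lower bound
    2. Two distinct ends have degree sum at most 4, so both degrees are exactly 2.\<close>
  proof (cases "p = q")
    case True
    then show False using s pq D by simp
  next
    case False
    then have "?d p + ?d q \<le> 4" using s D by simp
    then have "?d p = 2" "?d q = 2" using pq by auto
    then show False using neg False by auto
  qed
qed

text \<open>Edges inside both sets are counted on both sides; the union may in addition induce edges
  between the two differences.\<close>

lemma card_induced_supermodular:
  assumes "finite F"
  shows "card (induced F g S) + card (induced F g T)
    \<le> card (induced F g (S \<union> T)) + card (induced F g (S \<inter> T))"
proof -
  have fin: "finite (induced F g X)" for X using assms by (simp add: induced_def)
  have "card (induced F g S) + card (induced F g T)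
    = card (induced F g S \<union> induced F g T) + card (induced F g S \<inter> induced F g T)"
    by (rule card_Un_Int[OF fin fin])
  moreover have "induced F g S \<inter> induced F g T = induced F g (S \<inter> T)"
    by (auto simp: induced_def)
  moreover have "card (induced F g S \<union> induced F g T) \<le> card (induced F g (S \<union> T))"
    by (rule card_mono[OF fin]) (auto simp: induced_def)
  ultimately show ?thesis by simp
qed

text \<open>Sets on which the sparsity bound is attained and which contain a common vertex have a union on
  which it is attained; such a union containing all three neighbours would be overfull once the
  vertex itself is added. Hence one of two pairs of neighbours can be joined.\<close>

lemma degree_3_reducible_pair:
  assumes F: "sparse22 V F g" "finite V" "finite F" "edges_within V F g"
    and v: "v \<in> V" "card (incident F g v) = 3"
  obtains a b c x y z where "distinct [a, b, c]" "incident F g v = {a, b, c}"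
    "g a = {v, x}" "g b = {v, y}" "g c = {v, z}" "{x, y, z} \<subseteq> V - {v}" "x \<noteq> y"
    "\<forall>S\<subseteq>V - {v}. x \<in> S \<longrightarrow> y \<in> S \<longrightarrow> card (induced F g S) + 3 \<le> 2 * card S"
proof -
  \<comment> \<open>The constant 3 in place of 2 leaves room for one more edge in every set
    containing both vertices.\<close>
  define joinable where "joinable x y \<longleftrightarrow>
    (\<forall>S\<subseteq>V - {v}. x \<in> S \<longrightarrow> y \<in> S \<longrightarrow> card (induced F g S) + 3 \<le> 2 * card S)" for x y
  obtain a b c where abc: "incident F g v = {a, b, c}" "a \<noteq> b" "b \<noteq> c" "a \<noteq> c"
    using v(2) by (auto simp: card_3_iff)
  note other = incident_other_end[OF F(1,3,4)]
  obtain x where x: "x \<in> V - {v}" "g a = {v, x}" using other[of a v] abc by auto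
  obtain y where y: "y \<in> V - {v}" "g b = {v, y}" using other[of b v] abc by auto
  obtain z where z: "z \<in> V - {v}" "g c = {v, z}" using other[of c v] abc by auto
  \<comment> \<open>Adding \<open>v\<close> to \<open>S\<close> brings in its three edges but raises
    the bound by only 2.\<close>
  have key: "card (induced F g S) + 3 \<le> 2 * card S" if S: "S \<subseteq> V - {v}" "{x, y, z} \<subseteq> S" for S
  proof -
    have finS: "finite S" using S F(2) by (meson finite_Diff finite_subset)
    have abcF: "{a, b, c} \<subseteq> F" using abc(1) by (auto simp: incident_def)
    have "card (induced F g S) + 3 = card (induced F g S \<union> {a, b, c})"
    proof -
      have "induced F g S \<inter> {a, b, c} = {}" using x y z S by (auto simp: induced_def)
      then show ?thesis using F(3) abc by (subst card_Un_disjoint) (auto simp: induced_def)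
    qed
    also have "\<dots> \<le> card (induced F g (insert v S))"
      using F(3) abcF x y z S by (intro card_mono) (auto simp: induced_def)
    finally have "card (induced F g S) + 3 \<le> card (induced F g (insert v S))" .
    moreover have "card (induced F g (insert v S)) + 2 \<le> 2 * card (insert v S)"
      by (rule sparse22D[OF F(1)]) (use S v(1) in auto)
    moreover have "card (insert v S) = card S + 1" using S finS by (subst card_insert_disjoint) auto
    ultimately show ?thesis by linarith
  qed
  have "(x \<noteq> y \<and> joinable x y) \<or> (x \<noteq> z \<and> joinable x z)"
  proof (rule ccontr)
    assume neg: "\<not> ?thesis"
    \<comment> \<open>Three parallel edges at \<open>v\<close> would violate \<open>key\<close> on
      the single neighbour. If just one of the two pairs coincides, any set containing the other
      pair contains all three neighbours, so that pair is joinable.\<close>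
    have "x \<noteq> y \<or> x \<noteq> z"
    proof (rule ccontr)
      assume "\<not> (x \<noteq> y \<or> x \<noteq> z)"
      then show False using key[of "{x}"] x by simp
    qed
    moreover have "joinable x z" if "x = y" using key that by (auto simp: joinable_def)
    moreover have "joinable x y" if "x = z" using key that by (auto simp: joinable_def)
    ultimately have "\<not> joinable x y" "\<not> joinable x z" using neg by auto
    then obtain S T where S: "S \<subseteq> V - {v}" "x \<in> S" "y \<in> S" "\<not> card (induced F g S) + 3 \<le> 2 * card S"
      and T: "T \<subseteq> V - {v}" "x \<in> T" "z \<in> T" "\<not> card (induced F g T) + 3 \<le> 2 * card T"
      by (auto simp: joinable_def)
    have fin: "finite S" "finite T" using S T F(2) by (meson finite_Diff finite_subset)+
    have "card (induced F g (S \<inter> T)) + 2 \<le> 2 * card (S \<inter> T)"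
    proof -
      have "S \<inter> T \<subseteq> V" "S \<inter> T \<noteq> {}" using S T by auto
      then show ?thesis by (rule sparse22D[OF F(1)])
    qed
    moreover have "card (induced F g (S \<union> T)) + 3 \<le> 2 * card (S \<union> T)"
      by (rule key) (use S T in auto)
    \<comment> \<open>Together \<open>S\<close> and \<open>T\<close> induce at least 2|S| + 2|T| - 4
      edges, while union and intersection allow at most 2|S| + 2|T| - 5.\<close>
    moreover note card_induced_supermodular[OF F(3), of g S T] card_Un_Int[OF fin]
    ultimately show False using S(4) T(4) by linarith
  qed
  then show ?thesis
  proof
    assume "x \<noteq> y \<and> joinable x y"
    then show ?thesis
      by (intro that[of a b c x y z]) (use abc x y z in \<open>auto simp: joinable_def\<close>)
  next
    assume "x \<noteq> z \<and> joinable x z"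
    then show ?thesis
      by (intro that[of a c b x z y]) (use abc x y z in \<open>auto simp: joinable_def\<close>)
  qed
qed

text \<open>The label \<open>a\<close> now denotes the edge joining \<open>x\<close> and
  \<open>y\<close>. Only sets containing both can gain an edge, and for these the assumption leaves
  room for it.\<close>

lemma sparse22_join_neighbours:
  assumes F: "sparse22 V F g" "finite F"
    and inc: "incident F g v = {a, b, c}"
    and j: "\<forall>S\<subseteq>V - {v}. x \<in> S \<longrightarrow> y \<in> S \<longrightarrow> card (induced F g S) + 3 \<le> 2 * card S"
  shows "sparse22 (V - {v}) (F - {b, c}) (g(a := {x, y}))"
  unfolding sparse22_def
proof (intro allI impI)
  fix S assume S: "S \<subseteq> V - {v}" "S \<noteq> {}"
  let ?I = "induced (F - {b, c}) (g(a := {x, y})) S"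
  have fin: "finite (induced F g S)" using F(2) by (simp add: induced_def)
  show "card ?I + 2 \<le> 2 * card S"
  proof (cases "x \<in> S \<and> y \<in> S")
    case True
    have "card ?I \<le> card (insert a (induced F g S))"
      by (rule card_mono) (use fin in \<open>auto simp: induced_def split: if_splits\<close>)
    also have "\<dots> \<le> card (induced F g S) + 1" using fin by (simp add: card_insert_if)
    finally have "card ?I \<le> card (induced F g S) + 1" .
    moreover have "card (induced F g S) + 3 \<le> 2 * card S" using j S True by blast
    ultimately show ?thesis by linarith
  next
    case False
    have "card ?I \<le> card (induced F g S)"
      by (rule card_mono) (use fin False in \<open>auto simp: induced_def split: if_splits\<close>)
    moreover have "card (induced F g S) + 2 \<le> 2 * card S"
      by (rule sparse22D[OF F(1)]) (use S in auto)
    ultimately show ?thesis by linarith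
  qed
qed

section \<open>Inverse moves\<close>

lemma constructible_move: "constructible G \<Longrightarrow> move G G' \<Longrightarrow> constructible G'"
  unfolding constructible_def by (meson rtranclp.rtrancl_into_rtrancl)

definition remove_degree_2 :: "('v, 'e) mgraph \<Rightarrow> 'v \<Rightarrow> 'e \<Rightarrow> 'e \<Rightarrow> ('v, 'e) mgraph" where
  "remove_degree_2 G v a b = \<lparr>verts = verts G - {v}, edges = edges G - {a, b}, ends = ends G\<rparr>"

text \<open>The label \<open>a\<close> is reused for the edge that the forward move removes.\<close>

definition remove_degree_3 ::
    "('v, 'e) mgraph \<Rightarrow> 'v \<Rightarrow> 'e \<Rightarrow> 'e \<Rightarrow> 'e \<Rightarrow> 'v \<Rightarrow> 'v \<Rightarrow> ('v, 'e) mgraph" where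
  "remove_degree_3 G v a b c x y =
     \<lparr>verts = verts G - {v}, edges = edges G - {b, c}, ends = (ends G)(a := {x, y})\<rparr>"

lemma move_remove_degree_2:
  assumes "v \<in> verts G" "a \<in> edges G" "b \<in> edges G" "a \<noteq> b"
    and "ends G a = {v, x}" "ends G b = {v, y}" "x \<in> verts G - {v}" "y \<in> verts G - {v}"
  shows "move (remove_degree_2 G v a b) G"
proof (cases "x = y")
  case True
  have "move_1b (remove_degree_2 G v a b) G" unfolding move_1b_def remove_degree_2_def
    by - (rule exI[of _ v], rule exI[of _ x], rule exI[of _ a], rule exI[of _ b],
          use assms True in auto)
  then show ?thesis by (simp add: move_def)
next
  case False
  have "move_1a (remove_degree_2 G v a b) G" unfolding move_1a_def remove_degree_2_def
    by - (rule exI[of _ v], rule exI[of _ x], rule exI[of _ y], rule exI[of _ a],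
          rule exI[of _ b], use assms False in auto)
  then show ?thesis by (simp add: move_def)
qed

text \<open>The move splits the edge between \<open>x\<close> and \<open>y\<close> labelled
  \<open>a\<close>. It is 2a if the third neighbour \<open>z\<close> is new, and 2b with the double
  edge at \<open>z\<close> if \<open>z\<close> is one of these two.\<close>

lemma move_remove_degree_3:
  assumes "v \<in> verts G" "{a, b, c} \<subseteq> edges G" "distinct [a, b, c]"
    and "ends G a = {v, x}" "ends G b = {v, y}" "ends G c = {v, z}"
    and "{x, y, z} \<subseteq> verts G - {v}" "x \<noteq> y"
  shows "move (remove_degree_3 G v a b c x y) G"
proof -
  consider "z = y" | "z = x" | "z \<noteq> x" "z \<noteq> y" by blast
  then show ?thesis
  proof cases
    case 1
    have "move_2b (remove_degree_3 G v a b c x y) G" unfolding move_2b_def remove_degree_3_def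
      by - (rule exI[of _ v], rule exI[of _ x], rule exI[of _ y], rule exI[of _ a],
          rule exI[of _ a], rule exI[of _ b], rule exI[of _ c], use assms 1 in auto)
    then show ?thesis by (simp add: move_def)
  next
    case 2
    have "move_2b (remove_degree_3 G v a b c x y) G" unfolding move_2b_def remove_degree_3_def
      by - (rule exI[of _ v], rule exI[of _ y], rule exI[of _ x], rule exI[of _ a],
          rule exI[of _ b], rule exI[of _ a], rule exI[of _ c], use assms 2 in auto)
    then show ?thesis by (simp add: move_def)
  next
    case 3
    have "move_2a (remove_degree_3 G v a b c x y) G" unfolding move_2a_def remove_degree_3_def
      by - (rule exI[of _ v], rule exI[of _ x], rule exI[of _ y], rule exI[of _ z],
          rule exI[of _ a], rule exI[of _ a], rule exI[of _ b], rule exI[of _ c],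
          use assms 3 in auto)
    then show ?thesis by (simp add: move_def)
  qed
qed

lemma finite_multigraph_remove_degree_2:
  assumes "finite_multigraph G" "incident (edges G) (ends G) v = {a, b}"
  shows "finite_multigraph (remove_degree_2 G v a b)"
proof -
  have "\<exists>p\<in>verts G - {v}. \<exists>q\<in>verts G - {v}. ends G e = {p, q}" if e: "e \<in> edges G - {a, b}" for e
  proof -
    have "v \<notin> ends G e" using e assms(2) by (auto simp: incident_def)
    moreover obtain p q where "p \<in> verts G" "q \<in> verts G" "ends G e = {p, q}"
      using e assms(1) by (auto simp: finite_multigraph_def multigraph_def)
    ultimately show ?thesis by auto
  qed
  then show ?thesis using assms(1)
    by (auto simp: finite_multigraph_def multigraph_def remove_degree_2_def)
qed

lemma finite_multigraph_remove_degree_3: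
  assumes "finite_multigraph G" "incident (edges G) (ends G) v = {a, b, c}"
    and "x \<in> verts G - {v}" "y \<in> verts G - {v}"
  shows "finite_multigraph (remove_degree_3 G v a b c x y)"
proof -
  have "\<exists>p\<in>verts G - {v}. \<exists>q\<in>verts G - {v}. ((ends G)(a := {x, y})) e = {p, q}"
    if e: "e \<in> edges G - {b, c}" for e
  proof (cases "e = a")
    case True
    then show ?thesis using assms(3,4) by auto
  next
    case False
    then have "v \<notin> ends G e" using e assms(2) by (auto simp: incident_def)
    moreover obtain p q where "p \<in> verts G" "q \<in> verts G" "ends G e = {p, q}"
      using e assms(1) by (auto simp: finite_multigraph_def multigraph_def)
    ultimately show ?thesis using False by auto
  qed
  then show ?thesis using assms(1)
    unfolding finite_multigraph_def multigraph_def remove_degree_3_def by simp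
qed

section \<open>Construction of the graph by induction on the number of vertices\<close>

lemma card_remove_two:
  assumes "finite E" "a \<in> E" "b \<in> E" "a \<noteq> b"
  shows "card E = card (E - {a, b}) + 2"
proof -
  have "card (E - {a, b}) = card E - card {a, b}" using assms by (intro card_Diff_subset) auto
  moreover have "card {a, b} \<le> card E" using assms by (intro card_mono) auto
  ultimately show ?thesis using assms by simp
qed

text \<open>Strong induction on the number of vertices. The edge \<open>e0\<close> is generalized
  because another edge takes its place when both its ends have degree 2 in G - e0.\<close>

lemma constructible_if_sparse22:
  assumes "finite_multigraph G" "e0 \<in> edges G"
    and "sparse22 (verts G) (edges G - {e0}) (ends G)"
    and "card (edges G) + 1 = 2 * card (verts G)"
  shows "constructible G"
  using assms
proof (induction "card (verts G)" arbitrary: G e0 rule: less_induct)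
  case less
  let ?V = "verts G" and ?E = "edges G" and ?g = "ends G"
  let ?F = "edges G - {e0}"
  note fmg = less.prems(1) and e0 = less.prems(2) and sp = less.prems(3) and cE = less.prems(4)
  have fin: "finite ?V" "finite ?E" "finite ?F" and ew: "edges_within ?V ?E ?g"
    using fmg by (auto simp: finite_multigraph_def multigraph_edges_within)
  have ewF: "edges_within ?V ?F ?g" using ew by (auto simp: edges_within_def)
  have cF: "card ?F + 2 = 2 * card ?V" using card.remove[OF fin(2) e0] cE by simp
  note other = incident_other_end[OF sp fin(3) ewF]
  \<comment> \<open>Each inverse move loses one vertex and, in total, two edges, which preserves
    \<open>card E + 1 = 2 * card V\<close>.\<close>
  have IH: "constructible G" if mv: "move G' G" and "finite_multigraph G'"
    "e1 \<in> edges G'" "sparse22 (verts G') (edges G' - {e1}) (ends G')"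
    and c: "card (verts G') + 1 = card ?V" "card (edges G') + 2 = card ?E" for G' e1
  proof -
    have "constructible G'" by (rule less.hyps[of G' e1]) (use that c cE in auto)
    then show ?thesis using constructible_move mv by blast
  qed
  have cV: "card (?V - {v}) + 1 = card ?V" if "v \<in> ?V" for v using card.remove[OF fin(1) that] by simp
  have c2: "card (?E - {a, b}) + 2 = card ?E" if "a \<in> ?E" "b \<in> ?E" "a \<noteq> b" for a b
    using card_remove_two[OF fin(2) that] by simp
  have "card ?V \<noteq> 0" using cE by auto
  then consider "card ?V = 1" | "card ?V \<ge> 2" by linarith
  then show ?case
  proof cases
    case 1
    then obtain v where v: "?V = {v}" by (auto simp: card_1_singleton_iff)
    have "card ?E = 1" using cE 1 by simp
    then have "?E = {e0}" using e0 by (auto simp: card_1_singleton_iff)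
    moreover have "?g e0 = {v}" using ew e0 v by (auto simp: edges_within_def)
    ultimately have "is_K11 G" using v by (auto simp: is_K11_def)
    then show ?thesis by (auto simp: constructible_def)
  next
    case 2
    obtain p q where pq: "p \<in> ?V" "q \<in> ?V" "?g e0 = {p, q}"
      using ew e0 by (auto simp: edges_within_def)
    have "(\<exists>v\<in>?V - ?g e0. card (incident ?F ?g v) = 2 \<or> card (incident ?F ?g v) = 3) \<or>
      (p \<noteq> q \<and> card (incident ?F ?g p) = 2 \<and> card (incident ?F ?g q) = 2)"
      by (rule small_degree_vertex[OF sp fin(1,3) ewF cF 2]) (use pq in auto)
    then consider (two) v where "v \<in> ?V" "v \<notin> ?g e0" "card (incident ?F ?g v) = 2"
      | (three) v where "v \<in> ?V" "v \<notin> ?g e0" "card (incident ?F ?g v) = 3"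
      | (ends) "p \<noteq> q" "card (incident ?F ?g p) = 2" "card (incident ?F ?g q) = 2"
      by blast
    then show ?thesis
    proof cases
      case two
      then obtain a b where ab: "incident ?F ?g v = {a, b}" "a \<noteq> b" by (auto simp: card_2_iff)
      then obtain x y where xy: "x \<in> ?V - {v}" "?g a = {v, x}" "y \<in> ?V - {v}" "?g b = {v, y}"
        using other[of a v] other[of b v] by auto
      \<comment> \<open>Since \<open>v\<close> is off \<open>e0\<close>, its edges in G are those in
        G - e0, and \<open>e0\<close> survives the removal.\<close>
      have inc: "incident ?E ?g v = {a, b}" using ab two by (auto simp: incident_def)
      have abE: "a \<in> ?E" "b \<in> ?E" "e0 \<noteq> a" "e0 \<noteq> b" using ab(1) by (auto simp: incident_def)
      show ?thesis
      proof (rule IH[of "remove_degree_2 G v a b" e0])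
        show "move (remove_degree_2 G v a b) G"
          by (rule move_remove_degree_2[OF two(1) abE(1,2) ab(2) xy(2,4,1,3)])
        show "finite_multigraph (remove_degree_2 G v a b)"
          by (rule finite_multigraph_remove_degree_2[OF fmg inc])
        show "sparse22 (verts (remove_degree_2 G v a b)) (edges (remove_degree_2 G v a b) - {e0})
            (ends (remove_degree_2 G v a b))"
          by (rule sparse22_mono[OF sp]) (use fin in \<open>auto simp: remove_degree_2_def\<close>)
      qed (use abE e0 cV[OF two(1)] c2[OF abE(1,2) ab(2)] in \<open>auto simp: remove_degree_2_def\<close>)
    next
      case three
      obtain a b c x y z where abc: "distinct [a, b, c]" "incident ?F ?g v = {a, b, c}"
        "?g a = {v, x}" "?g b = {v, y}" "?g c = {v, z}" "{x, y, z} \<subseteq> ?V - {v}" "x \<noteq> y"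
        "\<forall>S\<subseteq>?V - {v}. x \<in> S \<longrightarrow> y \<in> S \<longrightarrow> card (induced ?F ?g S) + 3 \<le> 2 * card S"
        by (rule degree_3_reducible_pair[OF sp fin(1,3) ewF three(1,3)])
      have inc: "incident ?E ?g v = {a, b, c}" using abc(2) three by (auto simp: incident_def)
      have abcE: "{a, b, c} \<subseteq> ?E" "e0 \<noteq> a" "e0 \<noteq> b" "e0 \<noteq> c"
        using abc(2) by (auto simp: incident_def)
      have bc: "card (?E - {b, c}) + 2 = card ?E" using c2 abcE abc(1) by auto
      show ?thesis
      proof (rule IH[of "remove_degree_3 G v a b c x y" e0])
        show "move (remove_degree_3 G v a b c x y) G"
          by (rule move_remove_degree_3[OF three(1) abcE(1) abc(1,3-7)])
        show "finite_multigraph (remove_degree_3 G v a b c x y)"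
          by (rule finite_multigraph_remove_degree_3[OF fmg inc]) (use abc in auto)
        have "?E - {b, c} - {e0} = ?F - {b, c}" by auto
        then show "sparse22 (verts (remove_degree_3 G v a b c x y))
            (edges (remove_degree_3 G v a b c x y) - {e0}) (ends (remove_degree_3 G v a b c x y))"
          using sparse22_join_neighbours[OF sp fin(3) abc(2,8)] by (simp add: remove_degree_3_def)
      qed (use abcE e0 cV[OF three(1)] bc in \<open>auto simp: remove_degree_3_def\<close>)
    next
      case ends
      obtain a b where ab: "incident ?F ?g p = {a, b}" "a \<noteq> b"
        using ends(2) by (auto simp: card_2_iff)
      then obtain x y where xy: "x \<in> ?V - {p}" "?g a = {p, x}" "y \<in> ?V - {p}" "?g b = {p, y}"
        using other[of a p] other[of b p] by auto
      have inc: "incident ?E ?g p = {e0, a, b}" using ab pq e0 by (auto simp: incident_def)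
      have abE: "a \<in> ?E" "b \<in> ?E" "e0 \<noteq> a" "e0 \<noteq> b" using ab(1) by (auto simp: incident_def)
      \<comment> \<open>If \<open>p\<close> has a neighbour \<open>x\<close> other than \<open>q\<close>, the new edge \<open>xq\<close> takes over the role of
        \<open>e0\<close>: what remains without it is tight already.\<close>
      have reduce: "constructible G" if "{a', b'} = {a, b}" "a' \<noteq> b'" "?g a' = {p, x'}" "?g b' = {p, y'}"
        "x' \<noteq> q" "{x', y'} \<subseteq> ?V - {p}" for a' b' x' y'
      proof -
        \<comment> \<open>The label \<open>a'\<close> passes to the new edge and becomes the
          distinguished one; the edges other than \<open>a'\<close> all belong to the old
          \<open>?F\<close>, so sparsity is inherited.\<close>
        let ?G = "remove_degree_3 G p a' e0 b' x' q"
        have E': "a' \<in> ?E" "b' \<in> ?E" "e0 \<noteq> a'" "e0 \<noteq> b'" using that(1) abE by (auto simp: doubleton_eq_iff)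
        have inc': "incident ?E ?g p = {a', e0, b'}" using that(1) inc by auto
        show ?thesis
        proof (rule IH[of ?G a'])
          show "move ?G G"
            by (rule move_remove_degree_3[where z = y']) (use pq e0 E' that ends(1) in auto)
          show "finite_multigraph ?G"
            by (rule finite_multigraph_remove_degree_3[OF fmg inc']) (use pq that ends(1) in auto)
          show "sparse22 (verts ?G) (edges ?G - {a'}) (ends ?G)"
            by (rule sparse22_mono[OF sp]) (use fin in \<open>auto simp: remove_degree_3_def\<close>)
        qed (use E' that cV[OF pq(1)] c2[OF e0 E'(2,4)] in \<open>auto simp: remove_degree_3_def\<close>)
      qed
      consider "x \<noteq> q" | "y \<noteq> q" | "x = q" "y = q" by blast
      then show ?thesis
      proof cases
        case 1
        show ?thesis by (rule reduce[of a b x y]) (use 1 ab xy in auto)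
      next
        case 2
        show ?thesis by (rule reduce[of b a y x]) (use 2 ab xy in auto)
      next
        case 3
        \<comment> \<open>Both edges at \<open>p\<close> lead to \<open>q\<close>, so they also
          exhaust the degree 2 of \<open>q\<close>.\<close>
        have "{a, b} \<subseteq> incident ?F ?g q" using abE xy 3 by (auto simp: incident_def)
        then have incq: "incident ?F ?g q = {a, b}"
          using ends(3) ab(2) fin(3)
          by (intro card_subset_eq[symmetric]) (auto simp: incident_def)
        have sub: "?E - {e0, a, b} \<subseteq> induced ?F ?g (?V - {p, q})"
        proof
          fix e assume e: "e \<in> ?E - {e0, a, b}"
          then have "e \<notin> incident ?F ?g p" "e \<notin> incident ?F ?g q" using ab incq by auto
          then have "p \<notin> ?g e" "q \<notin> ?g e" using e by (auto simp: incident_def)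
          moreover have "?g e \<subseteq> ?V" using ew e by (auto simp: edges_within_def)
          ultimately show "e \<in> induced ?F ?g (?V - {p, q})" using e by (auto simp: induced_def)
        qed
        have c3: "card ?F = card (?E - {e0, a, b}) + 2"
        proof -
          have "?F - {a, b} = ?E - {e0, a, b}" by auto
          then show ?thesis using card_remove_two[OF fin(3), of a b] abE ab(2) by auto
        qed
        have cpq: "card ?V = card (?V - {p, q}) + 2"
          by (rule card_remove_two[OF fin(1) pq(1,2) ends(1)])
        \<comment> \<open>All 2|V| - 4 remaining edges avoid \<open>p\<close> and \<open>q\<close>,
          but a nonempty rest of |V| - 2 vertices would induce at most 2|V| - 6.\<close>
        have V: "?V - {p, q} = {}"
        proof (rule ccontr)
          assume "?V - {p, q} \<noteq> {}"
          then have "card (induced ?F ?g (?V - {p, q})) + 2 \<le> 2 * card (?V - {p, q})"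
            by (intro sparse22D[OF sp]) auto
          moreover have "card (?E - {e0, a, b}) \<le> card (induced ?F ?g (?V - {p, q}))"
            using sub fin by (intro card_mono) (auto simp: induced_def)
          ultimately show False using c3 cpq cF by linarith
        qed
        then have "card (?V - {p, q}) = 0" by (metis card.empty)
        then have "card (?E - {e0, a, b}) = 0" using cpq c3 cF by linarith
        then have "?E - {e0, a, b} = {}" using fin by (simp del: Diff_eq_empty_iff)
        then have "?E = {e0, a, b}" using abE e0 by auto
        moreover have "?V = {p, q}" using V pq by auto
        ultimately have "is_K23 G" unfolding is_K23_def
          by - (rule exI[of _ p], rule exI[of _ q], rule exI[of _ e0], rule exI[of _ a],
          rule exI[of _ b], use 3 pq xy abE ab ends(1) in auto)
        then show ?thesis by (auto simp: constructible_def)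
      qed
    qed
  qed
qed

theorem theorem5p11:
  fixes G :: "('v, 'e) mgraph"
  assumes "finite_multigraph G"
  shows "(P21_graph G \<longleftrightarrow> constructible G) \<and>
         (constructible G \<longleftrightarrow> tree_map_decomposable G)"
  using P21_graph_iff[OF assms] constructible_if_sparse22[OF assms]
    constructible_two_trees_plus_edge tree_map_decomposable_iff[OF assms]
    two_trees_plus_edge_P21_graph[OF assms]
  by blast

end
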